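(* Let $T$ be an invertible tree on $2n$ vertices and let $\widetilde{T}$ be a tree obtained from $T$ by tree-exchange. Then $\lambda_n(T) < \lambda_n(\widetilde{T})$.
   Context: For a graph $X$, $A(X)$ denotes its adjacency matrix and $\lambda_i(X)$ denotes the $i$th largest eigenvalue of $A(X)$ (with multiplicity). A tree $T$ is invertible if $A(T)$ is invertible; equivalently, $T$ has a perfect matching, which is then unique and denoted $M$. Edges of $M$ are called matching edges and all other edges are non-matching edges. The inverse graph $T^{-1}$ of an invertible tree $T$ is the graph on vertex set $V(T)$ in which distinct vertices $a,b$ are adjacent if and only if $(A(T)^{-1})_{a,b}\neq 0$ (the matrix $A(T)^{-1}$ has zero diagonal and entries in $\{0,\pm1\}$). Let $\phi$ be the involution of $V(T)$ that swaps the two ends of every edge of $M$; for a pair $e=uv$ write $\phi(e)=\phi(u)\phi(v)$, and let $\phi(T)$ be the tree on $V(T)$ with edge set $\{\phi(g): g\in E(T)\}$; it is a subgraph of $T^{-1}$. Tree-exchange: suppose $T^{-1}$ contains an edge $e\notin E(\phi(T))$ (so $\phi(e)\notin E(T)$). Let $f\in E(T)$ be any non-matching edge of $T$ lying on the fundamental cycle of $\phi(e)$, i.e. the unique cycle of $T\cup\{\phi(e)\}$. Let $\tau(T,e,f)$ be the tree obtained from $T$ by adding the edge $\phi(e)$ and removing the edge $f$; the set $M$ is also a perfect matching of $\tau(T,e,f)$. A tree $\widetilde{T}$ is obtained from $T$ by tree-exchange if $\widetilde{T}=\tau(T,e,f)$ for some such $e$ and $f$. *)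

theory Defs
  imports "HOL-Analysis.Analysis" "HOL-Computational_Algebra.Polynomial"
    "HOL-Library.Multiset"
begin

text \<open>
  A graph is given by its set of edges, each edge being the two-element set of its ends. The
  vertex set is the whole (finite) type of vertices, so a graph on \<open>k\<close> vertices is a graph
  over a type with \<open>k\<close> elements.
\<close>

definition simple_graph :: "'a set set \<Rightarrow> bool" where
  "simple_graph E \<longleftrightarrow> (\<forall>e\<in>E. card e = 2)"

definition graph_connected :: "'a set set \<Rightarrow> bool" where
  "graph_connected E \<longleftrightarrow> (\<forall>u v. (u, v) \<in> {(x, y). {x, y} \<in> E}\<^sup>*)"

text \<open>A cycle is represented by its edge set.\<close>

definition is_cycle :: "'a set set \<Rightarrow> 'a set set \<Rightarrow> bool" where
  "is_cycle E C \<longleftrightarrow> C \<subseteq> E \<and>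
     (\<exists>vs. distinct vs \<and> length vs \<ge> 3 \<and>
       C = {{vs ! i, vs ! (Suc i mod length vs)} | i. i < length vs})"

definition is_tree :: "'a set set \<Rightarrow> bool" where
  "is_tree E \<longleftrightarrow> simple_graph E \<and> graph_connected E \<and> (\<nexists>C. is_cycle E C)"

definition adj_matrix :: "'a set set \<Rightarrow> real ^ 'a ^ 'a" where
  "adj_matrix E = (\<chi> i j. if {i, j} \<in> E then 1 else 0)"

text \<open>The characteristic polynomial \<open>det (x I - A)\<close>, as a determinant over the polynomial ring.\<close>

definition charpoly :: "real ^ 'a ^ 'a \<Rightarrow> real poly" where
  "charpoly A = det (\<chi> i j. (if i = j then [:0, 1:] else 0) - [:A $ i $ j:])"

text \<open>
  \<open>eig i E\<close> is the \<open>i\<close>-th largest adjacency eigenvalue, counted with multiplicity and with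
  indices starting at 1. All eigenvalues of the symmetric matrix \<open>adj_matrix E\<close> are real, so
  the list of real roots of the characteristic polynomial has an entry for every \<open>i\<close> from 1 to
  the number of vertices.
\<close>

definition eig :: "nat \<Rightarrow> 'a::finite set set \<Rightarrow> real" where
  "eig i E = rev (sorted_list_of_multiset (proots (charpoly (adj_matrix E)))) ! (i - 1)"

definition inverse_graph :: "'a::finite set set \<Rightarrow> 'a set set" where
  "inverse_graph E = {{a, b} | a b. a \<noteq> b \<and> matrix_inv (adj_matrix E) $ a $ b \<noteq> 0}"

definition perfect_matching :: "'a set set \<Rightarrow> 'a set set \<Rightarrow> bool" where
  "perfect_matching E M \<longleftrightarrow> M \<subseteq> E \<and> (\<forall>v. \<exists>!e. e \<in> M \<and> v \<in> e)"

text \<open>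
  For a perfect matching \<open>M\<close>, \<open>mate M\<close> is the involution \<open>\<phi>\<close> swapping the ends of every
  matching edge. It acts on an edge \<open>e\<close> as the image \<open>mate M ` e\<close>, so the edge set of
  \<open>\<phi>(E)\<close> is \<open>phi_graph M E\<close>.
\<close>

definition mate :: "'a set set \<Rightarrow> 'a \<Rightarrow> 'a" where
  "mate M v = (THE w. {v, w} \<in> M)"

definition phi_graph :: "'a set set \<Rightarrow> 'a set set \<Rightarrow> 'a set set" where
  "phi_graph M E = (\<lambda>g. mate M ` g) ` E"

definition tau :: "'a set set \<Rightarrow> 'a set set \<Rightarrow> 'a set \<Rightarrow> 'a set \<Rightarrow> 'a set set" where
  "tau M T e f = insert (mate M ` e) T - {f}"

text \<open>
  An invertible tree \<open>T\<close> has exactly one perfect matching \<open>M\<close>, and \<open>T\<close> with the edge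
  \<open>\<phi>(e)\<close> added has exactly one cycle \<open>C\<close>, so the bound \<open>M\<close> and \<open>C\<close> below are determined by
  \<open>T\<close> and \<open>e\<close>.
\<close>

definition tree_exchange :: "'a::finite set set \<Rightarrow> 'a set set \<Rightarrow> bool" where
  "tree_exchange T T' \<longleftrightarrow>
     (\<exists>M e f C. perfect_matching T M \<and>
        e \<in> inverse_graph T \<and> e \<notin> phi_graph M T \<and>
        is_cycle (insert (mate M ` e) T) C \<and>
        f \<in> T \<and> f \<notin> M \<and> f \<in> C \<and>
        T' = tau M T e f)"

end

theory Submission
  imports Defs "HOL-Computational_Algebra.Fundamental_Theorem_Algebra"
begin

text \<open>
  A tree is bipartite, so its spectrum is symmetric about \<open>0\<close>; as the tree is invertible, the middle
  eigenvalue \<open>\<lambda>\<^sub>n\<close> is the least positive one (\<open>eig_least_positive\<close>). All signings of the edges of a tree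
  are equivalent, so the adjacency matrix has the same spectrum as the signed matrix \<open>K\<close> with entries
  \<open>1\<close> on the matching and \<open>- 1\<close> on the other edges (\<open>switching\<close>). The inverse \<open>Q\<close> of \<open>K\<close> counts alternating
  paths and is therefore nonnegative (\<open>signed_adj_path_matrix\<close>, \<open>path_matrix_nonneg\<close>), and \<open>1 / \<lambda>\<^sub>n\<close> is
  the largest eigenvalue of \<open>Q\<close>.

  Contracting the matching turns the alternating paths into the directed paths of an oriented tree.
  There the exchange adds a shortcut from the start to the end of a directed path and deletes an arc
  of that path. It creates no new pair of vertices joined by a directed path and destroys some, so
  \<open>Q\<close> can only decrease in each entry, and it does change (\<open>path_matrix_exchange\<close>). As the tree is
  connected, \<open>Q\<close> is irreducible: an eigenvector of its largest eigenvalue that is nonnegative is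
  positive (\<open>nonneg_eigenvector_positive\<close>). Decreasing an entry then makes the largest eigenvalue
  strictly smaller, and its reciprocal \<open>\<lambda>\<^sub>n\<close> strictly larger.
\<close>

section \<open>Cuts and potentials in forests\<close>

definition crosses :: "'a set \<Rightarrow> 'a set \<Rightarrow> bool" where
  "crosses X e \<longleftrightarrow> e \<inter> X \<noteq> {} \<and> e - X \<noteq> {}"

lemma crosses_pair [simp]: "crosses X {a, b} \<longleftrightarrow> (a \<in> X) \<noteq> (b \<in> X)"
  by (auto simp: crosses_def)

text \<open>
  In a forest every edge is a bridge, so some set of vertices is left by that edge and by no
  other. Forests enter all arguments below only through these cuts: they give potentials by
  summing over edges, and under an edge exchange they change by symmetric differences, so that
  paths and cycles need to be handled only in passing to and from cuts.
\<close>

definition cut_forest :: "'a set set \<Rightarrow> bool" where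
  "cut_forest E \<longleftrightarrow> (\<forall>e\<in>E. \<exists>X. crosses X e \<and> (\<forall>h\<in>E - {e}. \<not> crosses X h))"

lemma cut_forestE:
  assumes "cut_forest E"
  obtains X where "\<And>e. e \<in> E \<Longrightarrow> crosses (X e) e"
    and "\<And>e h. e \<in> E \<Longrightarrow> h \<in> E \<Longrightarrow> h \<noteq> e \<Longrightarrow> \<not> crosses (X e) h"
proof -
  have "\<exists>X. \<forall>e\<in>E. crosses (X e) e \<and> (\<forall>h\<in>E - {e}. \<not> crosses (X e) h)"
    using assms unfolding cut_forest_def by (rule bchoice)
  then obtain X where "\<forall>e\<in>E. crosses (X e) e \<and> (\<forall>h\<in>E - {e}. \<not> crosses (X e) h)" ..
  then show ?thesis by (intro that[of X]) auto
qed

text \<open>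
  A walk becomes a path by removing closed detours: when a new first vertex already occurs on
  the path, the path is cut down to start there.
\<close>

lemma rtrancl_distinct_path:
  assumes "(a, b) \<in> r\<^sup>*"
  shows "\<exists>vs. vs \<noteq> [] \<and> hd vs = a \<and> last vs = b \<and> distinct vs \<and>
    (\<forall>i. Suc i < length vs \<longrightarrow> (vs ! i, vs ! Suc i) \<in> r)"
  using assms
proof (induction rule: converse_rtrancl_induct)
  case base
  show ?case by (rule exI[of _ "[b]"]) auto
next
  case (step a y)
  then obtain vs where vs: "vs \<noteq> []" "hd vs = y" "last vs = b" "distinct vs"
    "\<And>i. Suc i < length vs \<Longrightarrow> (vs ! i, vs ! Suc i) \<in> r" by blast
  show ?case
  proof (cases "a \<in> set vs")
    case True
    then obtain k where k: "k < length vs" "vs ! k = a" by (metis in_set_conv_nth)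
    show ?thesis
      by (rule exI[of _ "drop k vs"]) (use vs k in \<open>auto simp: hd_drop_conv_nth\<close>)
  next
    case False
    have "((a # vs) ! i, (a # vs) ! Suc i) \<in> r" if "Suc i < length (a # vs)" for i
      using that vs(1,2,5) step.hyps(1) by (cases i) (auto simp: hd_conv_nth)
    then show ?thesis using vs False by (intro exI[of _ "a # vs"]) auto
  qed
qed

text \<open>
  The cut of an edge is the set of vertices reachable from one end without that edge. If the other
  end were reachable too, a path to it together with the edge would be a cycle.
\<close>

lemma tree_imp_cut_forest:
  assumes "is_tree T"
  shows "cut_forest T"
  unfolding cut_forest_def
proof
  fix e assume e: "e \<in> T"
  with assms obtain a b where ab: "e = {a, b}" "a \<noteq> b"
    by (auto simp: is_tree_def simple_graph_def card_2_iff)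
  define r where "r = {(x, y). {x, y} \<in> T - {e}}"
  define X where "X = {x. (a, x) \<in> r\<^sup>*}"
  have "b \<notin> X"
  proof
    assume "b \<in> X"
    then obtain vs where vs: "vs \<noteq> []" "hd vs = a" "last vs = b" "distinct vs"
      "\<And>i. Suc i < length vs \<Longrightarrow> (vs ! i, vs ! Suc i) \<in> r"
      using rtrancl_distinct_path[of a b r] by (auto simp: X_def)
    have ends: "vs ! 0 = a" "vs ! (length vs - 1) = b"
      using vs by (simp_all add: hd_conv_nth last_conv_nth)
    have "length vs \<noteq> 0" "length vs \<noteq> 1" using vs(1) ends ab(2) by auto
    moreover have "length vs \<noteq> 2"
      using vs(5)[of 0] ends ab by (auto simp: r_def)
    ultimately have len: "length vs \<ge> 3" by linarith
    let ?C = "{{vs ! i, vs ! (Suc i mod length vs)} | i. i < length vs}"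
    have "?C \<subseteq> T"
    proof
      fix h assume "h \<in> ?C"
      then obtain i where i: "i < length vs" "h = {vs ! i, vs ! (Suc i mod length vs)}" by blast
      show "h \<in> T"
      proof (cases "Suc i < length vs")
        case True
        then show ?thesis using vs(5)[of i] i by (auto simp: r_def)
      next
        case False
        then have "Suc i = length vs" using i by linarith
        then have "i = length vs - 1" "Suc i mod length vs = 0" by auto
        then have "h = e" using i ends ab by auto
        then show ?thesis using e by simp
      qed
    qed
    then have "is_cycle T ?C" unfolding is_cycle_def using vs(4) len by blast
    with assms show False unfolding is_tree_def by blast
  qed
  moreover have "a \<in> X" by (simp add: X_def)
  moreover have "\<not> crosses X h" if h: "h \<in> T - {e}" for h
  proof -
    have "card h = 2" using assms h by (auto simp: is_tree_def simple_graph_def)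
    then obtain u v where uv: "h = {u, v}" by (auto simp: card_2_iff)
    have "(u, v) \<in> r" "(v, u) \<in> r" using h unfolding uv r_def by (auto simp: insert_commute)
    then show ?thesis unfolding uv X_def by (auto intro: rtrancl_into_rtrancl)
  qed
  ultimately show "\<exists>X. crosses X e \<and> (\<forall>h\<in>T - {e}. \<not> crosses X h)"
    unfolding ab by auto
qed

text \<open>
  Going round the cycle from one end of the edge to the other along the remaining edges, the side
  of the cut has to change somewhere.
\<close>

lemma cycle_crosses_twice:
  assumes "is_cycle E C" "f \<in> C" "crosses X f"
  shows "\<exists>h\<in>C. h \<noteq> f \<and> crosses X h"
proof (rule ccontr)
  assume "\<not> (\<exists>h\<in>C. h \<noteq> f \<and> crosses X h)"
  then have none: "\<not> crosses X h" if "h \<in> C" "h \<noteq> f" for h using that by blast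
  obtain vs where vs: "distinct vs" "length vs \<ge> 3"
    and C: "C = {{vs ! i, vs ! (Suc i mod length vs)} | i. i < length vs}"
    using assms(1) unfolding is_cycle_def by blast
  define n where "n = length vs"
  obtain i where i: "i < n" "f = {vs ! i, vs ! (Suc i mod n)}"
    using assms(2) unfolding C n_def by blast
  \<comment> \<open>The cycle read from the far end of \<open>f\<close>, so that \<open>f\<close> itself comes last.\<close>
  define u where "u j = vs ! ((Suc i + j) mod n)" for j
  have step: "u j \<in> X \<longleftrightarrow> u (Suc j) \<in> X" if j: "Suc j < n" for j
  proof -
    define p where "p = (Suc i + j) mod n"
    have p: "p < n" using i by (simp add: p_def)
    have "p \<noteq> i"
    proof
      assume "p = i"
      then have "(i + Suc j) mod n = (i + 0) mod n" using i by (simp add: p_def)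
      then have "n dvd Suc j"
        by (metis add_diff_cancel_left' add_0_right mod_eq_dvd_iff_nat le_add1)
      then show False using j by (auto dest: dvd_imp_le)
    qed
    have next_p: "vs ! (Suc p mod n) = u (Suc j)" unfolding p_def u_def by (simp add: mod_Suc_eq)
    have h: "{vs ! p, vs ! (Suc p mod n)} \<in> C" unfolding C using p n_def by blast
    have "{vs ! p, vs ! (Suc p mod n)} \<noteq> f"
    proof
      assume eq: "{vs ! p, vs ! (Suc p mod n)} = f"
      have inj: "x = y" if "vs ! x = vs ! y" "x < n" "y < n" for x y
        using that vs(1) by (simp add: nth_eq_iff_index_eq n_def)
      have lt: "Suc p mod n < n" "Suc i mod n < n" using i by auto
      have "vs ! p = vs ! i \<or> vs ! p = vs ! (Suc i mod n) \<and> vs ! (Suc p mod n) = vs ! i"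
        using eq unfolding i(2) doubleton_eq_iff by blast
      then have "Suc i mod n = p" "Suc p mod n = i"
        using inj lt p i(1) \<open>p \<noteq> i\<close> by blast+
      moreover have "n \<ge> 3" using vs(2) by (simp add: n_def)
      ultimately show False using p i(1) unfolding mod_Suc by (simp split: if_splits)
    qed
    then have "\<not> crosses X {vs ! p, vs ! (Suc p mod n)}" by (rule none[OF h])
    then show ?thesis unfolding next_p by (simp add: u_def p_def)
  qed
  have "j < n \<Longrightarrow> u j \<in> X \<longleftrightarrow> u 0 \<in> X" for j
    by (induction j) (use step in auto)
  from this[of "n - 1"] have "vs ! i \<in> X \<longleftrightarrow> vs ! (Suc i mod n) \<in> X"
    using i by (simp add: u_def)
  with assms(3) i show False by simp
qed

lemma crosses_sym_diff:
  assumes "card h = 2"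
  shows "crosses (sym_diff X Y) h \<longleftrightarrow> crosses X h \<noteq> crosses Y h"
  using assms by (auto simp: card_2_iff)

text \<open>
  The new edge crosses the cut of the removed edge \<open>f\<close>, because their cycle leaves that cut twice;
  so it inherits this cut. A cut of another edge which the new edge also crosses is repaired by
  the symmetric difference with the cut of \<open>f\<close>.
\<close>

lemma cut_forest_exchange:
  assumes simple: "simple_graph (insert g E)" and forest: "cut_forest E" and g: "g \<notin> E"
    and cyc: "is_cycle (insert g E) C" and f: "f \<in> E" "f \<in> C"
  shows "cut_forest (insert g E - {f})"
proof -
  obtain X where X: "\<And>e. e \<in> E \<Longrightarrow> crosses (X e) e"
    "\<And>e h. e \<in> E \<Longrightarrow> h \<in> E \<Longrightarrow> h \<noteq> e \<Longrightarrow> \<not> crosses (X e) h"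
    using forest by (rule cut_forestE) blast
  have gf: "crosses (X f) g"
    using cycle_crosses_twice[OF cyc f(2) X(1)[OF f(1)]] X(2)[OF f(1)] cyc
    unfolding is_cycle_def by blast
  have card2: "card h = 2" if "h \<in> insert g E" for h
    using simple that by (auto simp: simple_graph_def)
  show ?thesis
    unfolding cut_forest_def
  proof
    fix e assume e: "e \<in> insert g E - {f}"
    consider "e = g" | "e \<in> E" "\<not> crosses (X e) g" | "e \<in> E" "crosses (X e) g" using e by blast
    then show "\<exists>Y. crosses Y e \<and> (\<forall>h\<in>insert g E - {f} - {e}. \<not> crosses Y h)"
    proof cases
      case 1
      then show ?thesis using gf X(2)[OF f(1)] by (intro exI[of _ "X f"]) auto
    next
      case 2
      then show ?thesis using X by (intro exI[of _ "X e"]) auto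
    next
      case 3
      have "crosses (sym_diff (X e) (X f)) h \<longleftrightarrow> h = e" if "h \<in> insert g E - {f}" for h
      proof -
        have "crosses (X e) h \<longleftrightarrow> h = e \<or> h = g" using that 3 X by blast
        moreover have "crosses (X f) h \<longleftrightarrow> h = g" using that gf X f(1) by blast
        moreover have "e \<noteq> g" using 3 g by blast
        moreover have "card h = 2" using that card2 by blast
        ultimately show ?thesis using crosses_sym_diff by blast
      qed
      then show ?thesis using e by (intro exI[of _ "sym_diff (X e) (X f)"]) auto
    qed
  qed
qed

text \<open>
  The sign of a vertex is the product of \<open>s e\<close> over the edges whose cut contains the vertex. Only
  the cut of an edge separates its own ends. Hence a forest is bipartite (\<open>s = - 1\<close>), and all
  signings of its edges give similar adjacency matrices.
\<close>

lemma sign_potential: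
  fixes s :: "'a::finite set \<Rightarrow> real"
  assumes "cut_forest E" "\<And>e. s e = 1 \<or> s e = - 1"
  shows "\<exists>d. (\<forall>v. d v = 1 \<or> d v = - 1) \<and> (\<forall>u v. {u, v} \<in> E \<longrightarrow> d u * d v = s {u, v})"
proof -
  obtain X where X: "\<And>e. e \<in> E \<Longrightarrow> crosses (X e) e"
    "\<And>e h. e \<in> E \<Longrightarrow> h \<in> E \<Longrightarrow> h \<noteq> e \<Longrightarrow> \<not> crosses (X e) h"
    using assms(1) by (rule cut_forestE) blast
  define F where "F e v = (if v \<in> X e then s e else 1)" for e v
  have sq: "s e * s e = 1" for e using assms(2)[of e] by auto
  define d where "d v = (\<Prod>e\<in>E. F e v)" for v
  have "d v = 1 \<or> d v = - 1" for v
  proof -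
    have F: "F e v = 1 \<or> F e v = - 1" for e using assms(2)[of e] by (auto simp: F_def)
    have "(\<Prod>e\<in>S. F e v) = 1 \<or> (\<Prod>e\<in>S. F e v) = - 1" for S
    proof (induction S rule: infinite_finite_induct)
      case (insert e S)
      then show ?case using F[of e] by auto
    qed auto
    then show ?thesis unfolding d_def .
  qed
  moreover have "d u * d v = s {u, v}" if uv: "{u, v} \<in> E" for u v
  proof -
    have "d u * d v = (\<Prod>e\<in>E. F e u * F e v)" by (simp add: d_def prod.distrib)
    also have "\<dots> = F {u, v} u * F {u, v} v * (\<Prod>e\<in>E - {{u, v}}. F e u * F e v)"
      by (rule prod.remove[OF _ uv]) simp
    also have "(\<Prod>e\<in>E - {{u, v}}. F e u * F e v) = 1"
      using X(2)[OF _ uv] by (intro prod.neutral) (auto simp: F_def sq)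
    also have "F {u, v} u * F {u, v} v = s {u, v}" using X(1)[OF uv] by (auto simp: F_def)
    finally show ?thesis by simp
  qed
  ultimately show ?thesis by blast
qed

text \<open>
  With the signs \<open>c\<close> of a bipartition the equation becomes one for the differences of \<open>c v * H v\<close>
  along edges, which the sum over the cuts solves. The inner sum over \<open>e \<inter> X e\<close> has one term, the
  colour of the end of \<open>e\<close> inside its cut, and gives the orientation of \<open>e\<close>.
\<close>

lemma sum_potential:
  fixes t :: "'a::finite set \<Rightarrow> real"
  assumes "cut_forest E"
  shows "\<exists>H. \<forall>u v. {u, v} \<in> E \<longrightarrow> H u + H v = t {u, v}"
proof -
  obtain X where X: "\<And>e. e \<in> E \<Longrightarrow> crosses (X e) e"
    "\<And>e h. e \<in> E \<Longrightarrow> h \<in> E \<Longrightarrow> h \<noteq> e \<Longrightarrow> \<not> crosses (X e) h"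
    using assms(1) by (rule cut_forestE) blast
  obtain c :: "'a \<Rightarrow> real" where c: "\<And>v. c v = 1 \<or> c v = - 1"
    "\<And>u v. {u, v} \<in> E \<Longrightarrow> c u * c v = - 1"
    using sign_potential[OF assms, of "\<lambda>_. - 1"] by auto
  define F where "F e v = (if v \<in> X e then t e * (\<Sum>x\<in>e \<inter> X e. c x) else 0)" for e v
  define H where "H v = c v * (\<Sum>e\<in>E. F e v)" for v
  have one_sided: "H u + H v = t {u, v}" if uv: "{u, v} \<in> E" and u: "u \<in> X {u, v}" for u v
  proof -
    define S where "S = (\<Sum>e\<in>E - {{u, v}}. F e u)"
    have S': "S = (\<Sum>e\<in>E - {{u, v}}. F e v)"
      unfolding S_def using X(2)[OF _ uv] by (intro sum.cong) (auto simp: F_def)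
    have v: "v \<notin> X {u, v}" using X(1)[OF uv] u by simp
    then have "{u, v} \<inter> X {u, v} = {u}" using u by auto
    then have "(\<Sum>e\<in>E. F e u) = t {u, v} * c u + S" "(\<Sum>e\<in>E. F e v) = S"
      using u v by (simp_all add: sum.remove[OF _ uv] S_def[symmetric] S'[symmetric])
        (simp_all add: F_def)
    moreover have "c v = - c u" "c u * c u = 1" using c(1)[of u] c(1)[of v] c(2)[OF uv] by auto
    ultimately show ?thesis unfolding H_def by (simp add: algebra_simps)
  qed
  have "H u + H v = t {u, v}" if "{u, v} \<in> E" for u v
    using one_sided[of u v] one_sided[of v u] that X(1)[OF that]
    by (auto simp: insert_commute add.commute)
  then show ?thesis by blast
qed

section \<open>The characteristic polynomial of a symmetric matrix\<close>

lemma poly_charpoly: "poly (charpoly A) x = det (mat x - A)"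
  unfolding charpoly_def det_def
  by (simp add: poly_sum poly_prod mat_def, intro sum.cong refl arg_cong2[of _ _ _ _ "(*)"] prod.cong)
     (auto simp: sign_def)

lemma map_poly_of_real_hom:
  fixes p q :: "real poly"
  shows "map_poly complex_of_real (p + q) = map_poly complex_of_real p + map_poly complex_of_real q"
    and "map_poly complex_of_real (p * q) = map_poly complex_of_real p * map_poly complex_of_real q"
    and "poly (map_poly complex_of_real p) (complex_of_real x) = complex_of_real (poly p x)"
  by (simp_all add: poly_eq_iff coeff_map_poly coeff_mult poly_altdef degree_map_poly)

lemma poly_charpoly_complex:
  "poly (map_poly complex_of_real (charpoly A)) z = det (mat z - (\<chi> i j. complex_of_real (A $ i $ j)))"
proof -
  have hom_sum: "map_poly complex_of_real (sum f S) = (\<Sum>x\<in>S. map_poly complex_of_real (f x))"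
    for f :: "'b \<Rightarrow> real poly" and S
    by (induction S rule: infinite_finite_induct) (auto simp: map_poly_of_real_hom)
  have hom_prod: "map_poly complex_of_real (prod f S) = (\<Prod>x\<in>S. map_poly complex_of_real (f x))"
    for f :: "'b \<Rightarrow> real poly" and S
    by (induction S rule: infinite_finite_induct) (auto simp: map_poly_of_real_hom)
  have hom_sign: "map_poly complex_of_real (of_int (sign p)) = of_int (sign p)" for p :: "'b \<Rightarrow> 'b"
    by (simp add: sign_def one_pCons map_poly_pCons)
  have hom_entry: "map_poly complex_of_real ((if P then [:0, 1:] else 0) - [:a:])
      = (if P then [:0, 1:] else 0) - [:complex_of_real a:]" for P a
    by (simp add: map_poly_pCons)
  show ?thesis
    unfolding charpoly_def det_def
    by (simp add: hom_sum hom_prod hom_sign map_poly_of_real_hom hom_entry poly_sum poly_prod mat_def,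
        intro sum.cong refl arg_cong2[of _ _ _ _ "(*)"] prod.cong)
       (auto simp: sign_def)
qed

text \<open>
  This makes the characteristic polynomial of a \<open>k \<times> k\<close> matrix monic: the coefficient of \<open>x ^ k\<close> in each
  term of the Leibniz expansion of \<open>det (x I - A)\<close> is the corresponding term for \<open>det I = 1\<close>.
\<close>

lemma coeff_prod_of_linear:
  fixes f :: "'b \<Rightarrow> 'c::comm_ring_1 poly"
  assumes "finite S" "\<And>i. i \<in> S \<Longrightarrow> degree (f i) \<le> 1"
  shows "degree (\<Prod>i\<in>S. f i) \<le> card S \<and> coeff (\<Prod>i\<in>S. f i) (card S) = (\<Prod>i\<in>S. coeff (f i) 1)"
  using assms
proof (induction S rule: finite_induct)
  case (insert x S)
  then have d: "degree (f x) \<le> 1" and IH: "degree (\<Prod>i\<in>S. f i) \<le> card S"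
    "coeff (\<Prod>i\<in>S. f i) (card S) = (\<Prod>i\<in>S. coeff (f i) 1)" by auto
  have "degree (f x * (\<Prod>i\<in>S. f i)) \<le> 1 + card S"
    using degree_mult_le[of "f x" "\<Prod>i\<in>S. f i"] d IH by linarith
  moreover have "coeff (f x * (\<Prod>i\<in>S. f i)) (1 + card S) = coeff (f x) 1 * coeff (\<Prod>i\<in>S. f i) (card S)"
  proof -
    have "coeff (f x * (\<Prod>i\<in>S. f i)) (1 + card S)
        = (\<Sum>k\<le>1 + card S. coeff (f x) k * coeff (\<Prod>i\<in>S. f i) (1 + card S - k))"
      by (rule coeff_mult)
    also have "\<dots> = (\<Sum>k\<in>{1}. coeff (f x) k * coeff (\<Prod>i\<in>S. f i) (1 + card S - k))"
    proof (rule sum.mono_neutral_right)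
      show "\<forall>i\<in>{..1 + card S} - {1}. coeff (f x) i * coeff (\<Prod>i\<in>S. f i) (1 + card S - i) = 0"
      proof
        fix i assume i: "i \<in> {..1 + card S} - {1}"
        show "coeff (f x) i * coeff (\<Prod>i\<in>S. f i) (1 + card S - i) = 0"
        proof (cases "i = 0")
          case True
          then show ?thesis using IH by (simp add: coeff_eq_0)
        next
          case False
          then have "i > degree (f x)" using i d by auto
          then show ?thesis by (simp add: coeff_eq_0)
        qed
      qed
    qed auto
    finally show ?thesis by simp
  qed
  ultimately show ?case using insert IH by simp
qed simp

lemma charpoly_monic:
  fixes A :: "real ^ 'a::finite ^ 'a"
  shows "degree (charpoly A) = CARD('a)" and "charpoly A \<noteq> 0"
proof -
  let ?M = "\<lambda>i j. (if i = j then [:0, 1:] else 0) - [:A $ i $ j:]"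
  have sgn: "of_int (sign p) = [:of_int (sign p) :: real:]" for p :: "'a \<Rightarrow> 'a"
    by (simp add: sign_def one_pCons)
  have entry: "degree (?M i j) \<le> 1" "coeff (?M i j) 1 = (if i = j then 1 else 0)" for i j
    by auto
  have prod: "degree (\<Prod>i\<in>UNIV. ?M i (p i)) \<le> CARD('a)"
    "coeff (\<Prod>i\<in>UNIV. ?M i (p i)) CARD('a) = (\<Prod>i\<in>UNIV. if i = p i then 1 else 0)" for p
    using coeff_prod_of_linear[of UNIV "\<lambda>i. ?M i (p i)"] entry by auto
  have cp: "charpoly A = (\<Sum>p | p permutes UNIV. [:of_int (sign p):] * (\<Prod>i\<in>UNIV. ?M i (p i)))"
    unfolding charpoly_def det_def by (simp only: sgn vec_lambda_beta)
  have le: "degree (charpoly A) \<le> CARD('a)"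
    unfolding cp using prod(1) by (intro degree_sum_le) auto
  have "coeff (charpoly A) CARD('a) = det (mat 1 :: real ^ 'a ^ 'a)"
    unfolding cp det_def by (simp add: coeff_sum prod(2) mat_def)
  then have one: "coeff (charpoly A) CARD('a) = 1" by simp
  show "degree (charpoly A) = CARD('a)"
    using le le_degree[of "charpoly A" "CARD('a)"] one by simp
  show "charpoly A \<noteq> 0" using one by auto
qed

lemma singular_iff_kernel:
  fixes A :: "'b::field ^ 'a::finite ^ 'a"
  shows "det A = 0 \<longleftrightarrow> (\<exists>v. v \<noteq> 0 \<and> A *v v = 0)"
proof -
  have "det A \<noteq> 0 \<longleftrightarrow> (\<exists>B. B ** A = mat 1)"
    unfolding invertible_det_nz[symmetric] invertible_def using matrix_left_right_inverse by blast
  then show ?thesis unfolding matrix_left_invertible_ker by blast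
qed

lemma poly_charpoly_eq_0_iff:
  "poly (charpoly A) x = 0 \<longleftrightarrow> (\<exists>v. v \<noteq> 0 \<and> A *v v = x *\<^sub>R v)"
proof -
  have "mat x *v v = x *\<^sub>R v" for v :: "real ^ 'a"
    by (simp add: vec_eq_iff matrix_vector_mult_def mat_def if_distrib[of "\<lambda>z. z * _"] cong: if_cong)
  then have "(mat x - A) *v v = 0 \<longleftrightarrow> A *v v = x *\<^sub>R v" for v
    by (auto simp: matrix_vector_mult_diff_rdistrib)
  then show ?thesis by (simp add: poly_charpoly singular_iff_kernel)
qed

lemma inner_symmetric_matrix:
  fixes A :: "real ^ 'a ^ 'a"
  assumes "transpose A = A"
  shows "x \<bullet> (A *v y) = (A *v x) \<bullet> y"
  by (metis assms dot_lmul_matrix vector_transpose_matrix)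

text \<open>
  For a complex eigenvector \<open>x + \<i> y\<close>, symmetry of the form \<open>x \<bullet> (A *v y)\<close> makes the imaginary part
  of the eigenvalue times \<open>|x|\<^sup>2 + |y|\<^sup>2\<close> vanish.
\<close>

lemma charpoly_symmetric_real_roots:
  fixes A :: "real ^ 'a ^ 'a"
  assumes sym: "transpose A = A" and root: "poly (map_poly complex_of_real (charpoly A)) z = 0"
  shows "Im z = 0"
proof -
  let ?C = "\<chi> i j. complex_of_real (A $ i $ j)"
  obtain v where v: "v \<noteq> 0" "(mat z - ?C) *v v = 0"
    using root unfolding poly_charpoly_complex singular_iff_kernel by blast
  have "mat z *v v = z *s v"
    by (simp add: vec_eq_iff matrix_vector_mult_def mat_def if_distrib[of "\<lambda>z. z * _"] cong: if_cong)
  with v have ev: "?C *v v = z *s v" by (simp add: matrix_vector_mult_diff_rdistrib)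
  define x y where "x = (\<chi> i. Re (v $ i))" and "y = (\<chi> i. Im (v $ i))"
  have comp: "(\<Sum>j\<in>UNIV. complex_of_real (A $ i $ j) * v $ j) = z * v $ i" for i
    using ev by (simp add: vec_eq_iff matrix_vector_mult_def)
  have Ax: "A *v x = Re z *\<^sub>R x - Im z *\<^sub>R y"
    using arg_cong[OF comp, of Re] by (simp add: vec_eq_iff matrix_vector_mult_def x_def y_def)
  have Ay: "A *v y = Im z *\<^sub>R x + Re z *\<^sub>R y"
    using arg_cong[OF comp, of Im] by (simp add: vec_eq_iff matrix_vector_mult_def x_def y_def)
  have "x \<bullet> (A *v y) = (A *v x) \<bullet> y" by (rule inner_symmetric_matrix[OF sym])
  then have "Im z * (x \<bullet> x + y \<bullet> y) = 0"
    by (simp add: Ax Ay algebra_simps inner_commute)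
  moreover have "x \<bullet> x + y \<bullet> y \<noteq> 0"
  proof
    assume "x \<bullet> x + y \<bullet> y = 0"
    then have "x = 0" "y = 0"
      by (metis add_nonneg_eq_0_iff inner_eq_zero_iff inner_ge_zero)+
    then have "v = 0" by (simp add: vec_eq_iff x_def y_def complex_eq_iff)
    with v show False by simp
  qed
  ultimately show ?thesis by simp
qed

text \<open>
  Real roots are split off one at a time; the fundamental theorem of algebra provides the next one.
\<close>

lemma size_proots_real_rooted:
  fixes p :: "real poly"
  assumes "p \<noteq> 0" and "\<And>z. poly (map_poly complex_of_real p) z = 0 \<Longrightarrow> Im z = 0"
  shows "size (proots p) = degree p"
  using assms
proof (induction "degree p" arbitrary: p)
  case 0
  then show ?case by (metis degree_eq_zeroE proots_const size_empty)
next
  case (Suc d)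
  have "degree (map_poly complex_of_real p) = degree p" by (simp add: degree_map_poly)
  then have "\<not> constant (poly (map_poly complex_of_real p))"
    using Suc.hyps(2) by (simp add: constant_degree)
  then obtain z where z: "poly (map_poly complex_of_real p) z = 0"
    using fundamental_theorem_of_algebra by blast
  with Suc.prems have "z = complex_of_real (Re z)" by (simp add: complex_eq_iff)
  with z have "complex_of_real (poly p (Re z)) = 0"
    by (metis map_poly_of_real_hom(3))
  then have "poly p (Re z) = 0" by simp
  then obtain q where q: "p = [:- Re z, 1:] * q" using poly_eq_0_iff_dvd by (metis dvdE)
  with Suc.prems have q0: "q \<noteq> 0" by auto
  then have "degree p = Suc (degree q)" unfolding q by (subst degree_mult_eq) auto
  moreover have "size (proots q) = degree q"
  proof (rule Suc.hyps(1))
    show "d = degree q" using Suc.hyps(2) \<open>degree p = Suc (degree q)\<close> by simp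
    show "Im w = 0" if "poly (map_poly complex_of_real q) w = 0" for w
      using Suc.prems(2)[of w] that unfolding q by (simp add: map_poly_of_real_hom del: mult_pCons_left)
  qed (fact q0)
  moreover have "size (proots p) = Suc (size (proots q))"
    unfolding q using q0 by (subst proots_mult) auto
  ultimately show ?case by simp
qed

text \<open>
  Substituting \<open>- x\<close> for \<open>x\<close> fixes the polynomial and exchanges the linear factors of \<open>a\<close> and \<open>- a\<close> up
  to sign.
\<close>

lemma order_even_poly:
  fixes p :: "real poly"
  assumes "p \<noteq> 0" "\<And>x. poly p (- x) = poly p x"
  shows "order (- a) p = order a p"
proof -
  have even: "pcompose p [:0, -1:] = p"
    using assms(2) by (intro poly_eq_poly_eq_iff[THEN iffD1]) (auto simp: poly_pcompose)
  have le: "order b p \<le> order (- b) p" for b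
  proof -
    obtain q where "p = [:- b, 1:] ^ order b p * q" using order_1[of b p] by (elim dvdE)
    then have "pcompose p [:0, -1:] = pcompose ([:- b, 1:] ^ order b p * q) [:0, -1:]" by simp
    moreover have "pcompose ([:- b, 1:] ^ k) [:0, -1:] = (- [:b, 1:]) ^ k" for k
      by (induction k) (simp_all add: pcompose_1 pcompose_mult pcompose_pCons del: mult_pCons_left)
    ultimately have "p = (- [:b, 1:]) ^ order b p * pcompose q [:0, -1:]"
      unfolding even by (simp add: pcompose_mult)
    then have "p = [:b, 1:] ^ order b p * ((- 1) ^ order b p * pcompose q [:0, -1:])"
      by (simp only: power_minus[of "[:b, 1:]"] ac_simps)
    then have "[:- (- b), 1:] ^ order b p dvd p" by (metis dvd_triv_left minus_minus)
    then show ?thesis unfolding order_divides using assms(1) by simp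
  qed
  show ?thesis using le[of a] le[of "- a"] by simp
qed

text \<open>
  By symmetry exactly half of the entries are positive, so in descending order the entry at
  position \<open>n\<close> (index \<open>n - 1\<close>) is the last positive one.
\<close>

lemma nth_of_symmetric_roots:
  fixes ms :: "real multiset"
  assumes size: "size ms = 2 * n" and n: "n > 0" and zero: "0 \<notin># ms"
    and sym: "\<And>a. count ms (- a) = count ms a"
  defines "x \<equiv> rev (sorted_list_of_multiset ms) ! (n - 1)"
  shows "x \<in># ms" and "x > 0" and "\<And>y. y \<in># ms \<Longrightarrow> y > 0 \<Longrightarrow> x \<le> y"
proof -
  define L where "L = rev (sorted_list_of_multiset ms)"
  have mset: "mset L = ms" and len: "length L = 2 * n"
    using size by (auto simp: L_def simp flip: size_mset)
  have x: "x = L ! (n - 1)" by (simp add: x_def L_def)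
  have desc: "L ! j \<le> L ! i" if "i \<le> j" "j < 2 * n" for i j
    using that len sorted_rev_nth_mono[of L i j] unfolding L_def by simp
  have neg: "image_mset uminus ms = ms"
  proof (rule multiset_eqI)
    fix a
    have "count (image_mset uminus M) a = count M (- a)" for M :: "real multiset"
      by (induction M) auto
    then show "count (image_mset uminus ms) a = count ms a" by (simp add: sym)
  qed
  have "size (filter_mset (\<lambda>y. y > 0) ms) = size (filter_mset (\<lambda>y. y > 0) (image_mset uminus ms))"
    by (simp only: neg)
  also have "\<dots> = size (filter_mset (\<lambda>y. \<not> y > 0) ms)"
  proof -
    have "filter_mset (\<lambda>y. - y > 0) ms = filter_mset (\<lambda>y. \<not> y > 0) ms"
      using zero by (intro filter_mset_cong) (auto simp: not_less less_le)
    then show ?thesis by (simp add: filter_mset_image_mset)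
  qed
  finally have half: "size (filter_mset (\<lambda>y. y > 0) ms) = size (filter_mset (\<lambda>y. \<not> y > 0) ms)" .
  moreover have "size ms = size (filter_mset (\<lambda>y. y > 0) ms) + size (filter_mset (\<lambda>y. \<not> y > 0) ms)"
    by (metis multiset_partition size_union)
  ultimately have "size (filter_mset (\<lambda>y. y > 0) ms) = n" "size (filter_mset (\<lambda>y. \<not> y > 0) ms) = n"
    using size by auto
  then have "length (filter (\<lambda>y. y > 0) L) = n" "length (filter (\<lambda>y. \<not> y > 0) L) = n"
    by (metis mset mset_filter size_mset)+
  then have pos: "card {i. i < 2 * n \<and> L ! i > 0} = n" and npos: "card {i. i < 2 * n \<and> \<not> L ! i > 0} = n"
    by (simp_all only: length_filter_conv_card len)
  show "x \<in># ms" unfolding x mset[symmetric] using len n by (simp add: nth_mem)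
  show "x > 0"
  proof (rule ccontr)
    assume "\<not> x > 0"
    then have "{n - 1..<2 * n} \<subseteq> {i. i < 2 * n \<and> \<not> L ! i > 0}"
      using desc[of "n - 1"] unfolding x by force
    from card_mono[OF _ this] show False using npos n by simp
  qed
  show "x \<le> y" if y: "y \<in># ms" "y > 0" for y
  proof (rule ccontr)
    assume "\<not> x \<le> y"
    obtain j where j: "j < 2 * n" "L ! j = y"
      using y(1) len unfolding mset[symmetric] by (metis in_set_conv_nth set_mset_mset)
    have "j > n - 1"
      using desc[of j "n - 1"] j n \<open>\<not> x \<le> y\<close> unfolding x by (cases "j \<le> n - 1") auto
    then have "i < 2 * n \<and> L ! i > 0" if "i \<le> n" for i
      using desc[of i j] j y(2) that by linarith
    then have "{..n} \<subseteq> {i. i < 2 * n \<and> L ! i > 0}" by blast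
    from card_mono[OF _ this] show False using pos by simp
  qed
qed

section \<open>Alternating walks and the inverse of the adjacency matrix\<close>

text \<open>
  Contracting the matching edges of a tree and orienting every other edge from one colour class to
  the other gives an oriented tree, whose directed paths are the alternating paths. The arcs below
  live on the vertices of the tree itself and so give two copies of the oriented tree, one on each
  colour class, with \<open>mate M\<close> as an arc-reversing isomorphism. An arc runs along a matching edge and
  then along a non-matching edge.
\<close>

definition alt_arc :: "'a set set \<Rightarrow> 'a set set \<Rightarrow> 'a \<Rightarrow> 'a \<Rightarrow> bool" where
  "alt_arc M E v w \<longleftrightarrow> {mate M v, w} \<in> E - M"

definition arc_matrix :: "'a set set \<Rightarrow> 'a set set \<Rightarrow> real ^ 'a ^ 'a" where
  "arc_matrix M E = (\<chi> v w. if alt_arc M E v w then 1 else 0)"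

text \<open>
  The sum of all powers of the arc matrix, which counts directed walks; it is finite because the
  arcs are acyclic.
\<close>

definition walk_matrix :: "'a::finite set set \<Rightarrow> 'a set set \<Rightarrow> real ^ 'a ^ 'a" where
  "walk_matrix M E = matrix_inv (mat 1 - arc_matrix M E)"

text \<open>
  In a tree this counts the alternating paths that begin and end with matching edges; it is the
  adjacency matrix of the inverse graph.
\<close>

definition path_matrix :: "'a::finite set set \<Rightarrow> 'a set set \<Rightarrow> real ^ 'a ^ 'a" where
  "path_matrix M E = (\<chi> v w. walk_matrix M E $ v $ mate M w)"

definition signed_adj :: "'a set set \<Rightarrow> 'a set set \<Rightarrow> real ^ 'a ^ 'a" where
  "signed_adj M E = (\<chi> v w. if {v, w} \<in> M then 1 else if {v, w} \<in> E then - 1 else 0)"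

lemma matrix_inv_inverse:
  fixes A :: "'b::semiring_1 ^ 'n ^ 'n"
  assumes "invertible A"
  shows "A ** matrix_inv A = mat 1" "matrix_inv A ** A = mat 1"
proof -
  have "A ** matrix_inv A = mat 1 \<and> matrix_inv A ** A = mat 1"
    using assms unfolding invertible_def matrix_inv_def by (rule someI_ex)
  then show "A ** matrix_inv A = mat 1" "matrix_inv A ** A = mat 1" by blast+
qed

lemma matrix_inv_eqI:
  fixes A B :: "'b::field ^ 'n::finite ^ 'n"
  assumes "A ** B = mat 1"
  shows "matrix_inv A = B"
proof -
  have "B ** A = mat 1" using assms matrix_left_right_inverse by blast
  then have "A ** matrix_inv A = mat 1"
    using assms by (intro matrix_inv_inverse) (auto simp: invertible_def)
  then have "B ** (A ** matrix_inv A) = B" by simp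
  then show ?thesis by (simp add: matrix_mul_assoc \<open>B ** A = mat 1\<close>)
qed

locale matched_forest =
  fixes M E :: "'a::finite set set"
  assumes simple: "simple_graph E" and forest: "cut_forest E" and matching: "perfect_matching E M"
begin

abbreviation mt :: "'a \<Rightarrow> 'a" where "mt \<equiv> mate M"
abbreviation arc :: "'a \<Rightarrow> 'a \<Rightarrow> bool" where "arc \<equiv> alt_arc M E"
abbreviation W :: "real ^ 'a ^ 'a" where "W \<equiv> walk_matrix M E"
abbreviation Q :: "real ^ 'a ^ 'a" where "Q \<equiv> path_matrix M E"

lemma no_loop: "{v, v} \<notin> E"
proof
  assume "{v, v} \<in> E"
  then have "card {v, v} = 2" using simple unfolding simple_graph_def by blast
  then show False by simp
qed

lemma matching_subset: "M \<subseteq> E"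
  using matching unfolding perfect_matching_def by (rule conjunct1)

lemma matching_edge_iff: "{v, w} \<in> M \<longleftrightarrow> w = mt v"
proof -
  obtain e where e: "e \<in> M" "v \<in> e" and uniq: "\<And>e'. e' \<in> M \<Longrightarrow> v \<in> e' \<Longrightarrow> e' = e"
    using matching unfolding perfect_matching_def by metis
  then have "card e = 2" using matching_subset simple unfolding simple_graph_def by blast
  then obtain x where x: "e = {v, x}" "x \<noteq> v" using e(2) by (auto simp: card_2_iff)
  have only: "{v, w'} \<in> M \<longleftrightarrow> w' = x" for w'
  proof
    assume "{v, w'} \<in> M"
    then have "{v, w'} = {v, x}" using uniq[of "{v, w'}"] x by simp
    then show "w' = x" using x(2) by (auto simp: doubleton_eq_iff)
  qed (use e(1) x in simp)
  then have "mt v = x" unfolding mate_def by simp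
  then show ?thesis using only by simp
qed

lemma mate_in_matching: "{v, mt v} \<in> M"
  by (simp add: matching_edge_iff)

lemma mate_mate [simp]: "mt (mt v) = v"
  using mate_in_matching[of v] matching_edge_iff[of "mt v" v] by (simp add: insert_commute)

lemma mate_eq_iff [simp]: "mt v = mt w \<longleftrightarrow> v = w"
  by (metis mate_mate)

lemma arc_reverse: "arc v w \<longleftrightarrow> arc (mt w) (mt v)"
  by (simp add: alt_arc_def insert_commute)

lemma arcs_reverse: "(v, w) \<in> {(x, y). arc x y}\<^sup>* \<Longrightarrow> (mt w, mt v) \<in> {(x, y). arc x y}\<^sup>*"
proof (induction rule: rtrancl_induct)
  case (step y z)
  then have "(mt z, mt y) \<in> {(x, y). arc x y}" using arc_reverse by auto
  with step.IH show ?case by (meson converse_rtrancl_into_rtrancl)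
qed simp

lemma bipartition:
  obtains c :: "'a \<Rightarrow> real" where "\<And>v. c v = 1 \<or> c v = - 1"
    "\<And>u v. {u, v} \<in> E \<Longrightarrow> c u = - c v"
proof -
  obtain c :: "'a \<Rightarrow> real" where c: "\<And>v. c v = 1 \<or> c v = - 1"
    "\<And>u v. {u, v} \<in> E \<Longrightarrow> c u * c v = - 1"
    using sign_potential[OF forest, of "\<lambda>_. - 1"] by auto
  have "c u = - c v" if "{u, v} \<in> E" for u v
    using c(1)[of u] c(1)[of v] c(2)[OF that] by auto
  with c(1) show ?thesis by (rule that)
qed

text \<open>
  Asking for \<open>H u + H v\<close> to be \<open>0\<close> on matching edges and \<open>1\<close> on other edges makes \<open>H\<close> grow by one along
  each arc, since an arc takes one edge of each kind.
\<close>

lemma height: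
  obtains H :: "'a \<Rightarrow> real" where "\<And>v w. arc v w \<Longrightarrow> H w = H v + 1"
proof -
  obtain H :: "'a \<Rightarrow> real" where H: "\<And>u v. {u, v} \<in> E \<Longrightarrow> H u + H v = (if {u, v} \<in> M then 0 else 1)"
    using sum_potential[OF forest, of "\<lambda>e. if e \<in> M then 0 else 1"] by auto
  have "H w = H v + 1" if "arc v w" for v w
    using H[of "mt v" w] H[of v "mt v"] that mate_in_matching[of v] matching_subset
    by (auto simp: alt_arc_def)
  then show ?thesis by (rule that)
qed

lemma arc_measure:
  obtains m :: "'a \<Rightarrow> nat" where "\<And>v w. arc v w \<Longrightarrow> m w < m v"
proof -
  obtain H :: "'a \<Rightarrow> real" where H: "\<And>v w. arc v w \<Longrightarrow> H w = H v + 1" by (rule height) blast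
  have "card {u. H w < H u} < card {u. H v < H u}" if "arc v w" for v w
  proof (rule psubset_card_mono)
    have "H w = H v + 1" using that by (rule H)
    then have "{u. H w < H u} \<subseteq> {u. H v < H u}" "w \<in> {u. H v < H u} - {u. H w < H u}"
      by auto
    then show "{u. H w < H u} \<subset> {u. H v < H u}" by blast
  qed simp
  then show ?thesis by (rule that)
qed

text \<open>
  Induction against the arcs: nonnegativity at the successors of a vertex passes to the vertex.
  Applied to vectors in the kernel and to columns of the inverse, this yields both the
  invertibility of \<open>I - R\<close>, for the arc matrix \<open>R\<close>, and the nonnegativity of its inverse.
\<close>

lemma nonneg_if_dominates_successors:
  assumes "\<And>v. (\<Sum>w\<in>UNIV. arc_matrix M E $ v $ w * x w) \<le> x v"
  shows "0 \<le> (x v :: real)"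
proof -
  obtain m :: "'a \<Rightarrow> nat" where m: "\<And>v w. arc v w \<Longrightarrow> m w < m v" by (rule arc_measure) blast
  show ?thesis
  proof (induction v rule: measure_induct_rule[of m])
    case (less v)
    have "0 \<le> arc_matrix M E $ v $ w * x w" for w
    proof (cases "arc v w")
      case True
      then have "0 \<le> x w" by (intro less m)
      then show ?thesis by (simp add: arc_matrix_def)
    qed (simp add: arc_matrix_def)
    then have "0 \<le> (\<Sum>w\<in>UNIV. arc_matrix M E $ v $ w * x w)" by (simp add: sum_nonneg)
    with assms[of v] show ?case by linarith
  qed
qed

lemma walk_matrix_inverse:
  "(mat 1 - arc_matrix M E) ** W = mat 1" "W ** (mat 1 - arc_matrix M E) = mat 1"
proof -
  let ?R = "arc_matrix M E"
  have "x = 0" if "(mat 1 - ?R) *v x = 0" for x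
  proof -
    have fix': "(\<Sum>w\<in>UNIV. ?R $ v $ w * x $ w) = x $ v" for v
    proof -
      have "?R *v x = x" using that by (simp add: matrix_vector_mult_diff_rdistrib)
      from arg_cong[OF this, of "\<lambda>z. z $ v"] show ?thesis by (simp add: matrix_vector_mult_def)
    qed
    have "0 \<le> x $ v" "0 \<le> - x $ v" for v
      using nonneg_if_dominates_successors[of "\<lambda>v. x $ v"]
        nonneg_if_dominates_successors[of "\<lambda>v. - x $ v"] fix' by (auto simp: sum_negf)
    then show "x = 0" by (simp add: vec_eq_iff order_antisym)
  qed
  then have "\<exists>B. B ** (mat 1 - ?R) = mat 1" unfolding matrix_left_invertible_ker by blast
  then have "invertible (mat 1 - ?R)" unfolding invertible_def using matrix_left_right_inverse by blast
  then show "(mat 1 - ?R) ** W = mat 1" "W ** (mat 1 - ?R) = mat 1"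
    unfolding walk_matrix_def by (simp_all add: matrix_inv_inverse)
qed

lemma walk_matrix_first_arc:
  "W $ v $ w = (if v = w then 1 else 0) + (\<Sum>u\<in>UNIV. arc_matrix M E $ v $ u * W $ u $ w)"
proof -
  have "(\<Sum>u\<in>UNIV. (mat 1 - arc_matrix M E) $ v $ u * W $ u $ w) = (if v = w then 1 else 0)"
    using arg_cong[OF walk_matrix_inverse(1), of "\<lambda>B. B $ v $ w"]
    by (simp add: mat_def matrix_matrix_mult_def)
  then show ?thesis
    by (simp add: mat_def left_diff_distrib sum_subtractf if_distrib[of "\<lambda>z. z * _"] cong: if_cong)
qed

lemma walk_matrix_last_arc:
  "W $ v $ w = (if v = w then 1 else 0) + (\<Sum>u\<in>UNIV. W $ v $ u * arc_matrix M E $ u $ w)"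
proof -
  have "(\<Sum>u\<in>UNIV. W $ v $ u * (mat 1 - arc_matrix M E) $ u $ w) = (if v = w then 1 else 0)"
    using arg_cong[OF walk_matrix_inverse(2), of "\<lambda>B. B $ v $ w"]
    by (simp add: mat_def matrix_matrix_mult_def)
  then show ?thesis
    by (simp add: mat_def right_diff_distrib sum_subtractf if_distrib[of "\<lambda>z. _ * z"] cong: if_cong)
qed

lemma walk_matrix_nonneg: "0 \<le> W $ v $ w"
  by (rule nonneg_if_dominates_successors[of "\<lambda>v. W $ v $ w"])
    (subst walk_matrix_first_arc[of _ w], simp)

lemma walk_matrix_diag: "1 \<le> W $ v $ v"
proof -
  have "0 \<le> (\<Sum>u\<in>UNIV. arc_matrix M E $ v $ u * W $ u $ v)"
    by (intro sum_nonneg) (simp add: arc_matrix_def walk_matrix_nonneg)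
  then show ?thesis by (subst walk_matrix_first_arc) simp
qed

text \<open>
  Any walk to \<open>u\<close> extends to \<open>w\<close> along a fixed walk from \<open>u\<close> to \<open>w\<close>.
\<close>

lemma walk_matrix_mono_target: "(u, w) \<in> {(x, y). arc x y}\<^sup>* \<Longrightarrow> W $ v $ u \<le> W $ v $ w"
proof (induction rule: rtrancl_induct)
  case (step y z)
  have "W $ v $ y = W $ v $ y * arc_matrix M E $ y $ z" using step by (simp add: arc_matrix_def)
  also have "\<dots> \<le> (\<Sum>u\<in>UNIV. W $ v $ u * arc_matrix M E $ u $ z)"
    by (rule member_le_sum) (auto simp: arc_matrix_def walk_matrix_nonneg)
  also have "\<dots> \<le> W $ v $ z" by (subst walk_matrix_last_arc[of v z]) simp
  finally show ?case using step.IH by simp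
qed simp

lemma walk_matrix_mono_source: "(u, w) \<in> {(x, y). arc x y}\<^sup>* \<Longrightarrow> W $ w $ v \<le> W $ u $ v"
proof (induction rule: converse_rtrancl_induct)
  case (step y z)
  have "W $ z $ v = arc_matrix M E $ y $ z * W $ z $ v" using step by (simp add: arc_matrix_def)
  also have "\<dots> \<le> (\<Sum>u\<in>UNIV. arc_matrix M E $ y $ u * W $ u $ v)"
    by (rule member_le_sum) (auto simp: arc_matrix_def walk_matrix_nonneg)
  also have "\<dots> \<le> W $ y $ v" by (subst walk_matrix_first_arc[of y v]) simp
  finally show ?case using step.IH by simp
qed simp

lemma walk_if_entry_nonzero: "W $ v $ w \<noteq> 0 \<Longrightarrow> (v, w) \<in> {(x, y). arc x y}\<^sup>*"
proof -
  obtain m :: "'a \<Rightarrow> nat" where m: "\<And>v w. arc v w \<Longrightarrow> m w < m v" by (rule arc_measure) blast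
  show "W $ v $ w \<noteq> 0 \<Longrightarrow> (v, w) \<in> {(x, y). arc x y}\<^sup>*"
  proof (induction v rule: measure_induct_rule[of m])
    case (less v)
    show ?case
    proof (cases "v = w")
      case False
      then have "(\<Sum>u\<in>UNIV. arc_matrix M E $ v $ u * W $ u $ w) \<noteq> 0"
        using less.prems walk_matrix_first_arc[of v w] by simp
      then obtain u where u: "arc_matrix M E $ v $ u * W $ u $ w \<noteq> 0" by (meson sum.neutral)
      then have arc: "arc v u" by (simp add: arc_matrix_def split: if_splits)
      then have "(u, w) \<in> {(x, y). arc x y}\<^sup>*"
        using u by (intro less.IH m) auto
      with arc show ?thesis by (meson case_prodI converse_rtrancl_into_rtrancl mem_Collect_eq)
    qed simp
  qed
qed

text \<open>
  With the permutation matrix \<open>P\<close> of \<open>mate M\<close>, the signed adjacency matrix is \<open>P (I - R)\<close> and the path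
  matrix is \<open>(I - R)\<^sup>-\<^sup>1 P\<close>.
\<close>

lemma signed_adj_path_matrix: "signed_adj M E ** Q = mat 1" "Q ** signed_adj M E = mat 1"
proof -
  have entry: "signed_adj M E $ v $ u = (mat 1 - arc_matrix M E) $ mt v $ u" for v u
    using matching_edge_iff[of v u] by (auto simp: signed_adj_def mat_def arc_matrix_def alt_arc_def)
  have "(signed_adj M E ** Q) $ v $ w = ((mat 1 - arc_matrix M E) ** W) $ mt v $ mt w" for v w
    by (simp add: matrix_matrix_mult_def entry path_matrix_def)
  then show "signed_adj M E ** Q = mat 1"
    unfolding walk_matrix_inverse by (simp add: vec_eq_iff mat_def)
  then show "Q ** signed_adj M E = mat 1" using matrix_left_right_inverse by blast
qed

lemma path_matrix_symmetric: "transpose Q = Q"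
proof -
  have sym: "transpose (signed_adj M E) = signed_adj M E"
    by (simp add: transpose_def signed_adj_def vec_eq_iff insert_commute)
  have "transpose Q = transpose Q ** (signed_adj M E ** Q)" by (simp add: signed_adj_path_matrix)
  also have "\<dots> = transpose (signed_adj M E ** Q) ** Q"
    by (simp add: matrix_transpose_mul sym matrix_mul_assoc)
  also have "\<dots> = Q" by (simp add: signed_adj_path_matrix)
  finally show ?thesis .
qed

lemma path_matrix_nonneg: "0 \<le> Q $ v $ w"
  by (simp add: path_matrix_def walk_matrix_nonneg)

text \<open>
  Being a forest, \<open>E\<close> has vertex signs that turn the non-matching edges negative and keep the
  matching edges positive. This is what makes the inverse nonnegative up to signs.
\<close>

lemma switching:
  obtains d where "\<And>v. d v = 1 \<or> d v = (- 1 :: real)"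
    "\<And>v w. adj_matrix E $ v $ w = d v * signed_adj M E $ v $ w * d w"
proof -
  have "\<exists>d. (\<forall>v. d v = 1 \<or> d v = - 1) \<and>
      (\<forall>u v. {u, v} \<in> E \<longrightarrow> d u * d v = (if {u, v} \<in> M then 1 else - 1 :: real))"
    by (rule sign_potential[OF forest, of "\<lambda>e. if e \<in> M then 1 else - 1"]) simp
  then obtain d :: "'a \<Rightarrow> real" where d: "\<And>v. d v = 1 \<or> d v = - 1"
    "\<And>u v. {u, v} \<in> E \<Longrightarrow> d u * d v = (if {u, v} \<in> M then 1 else - 1)"
    by blast
  have "adj_matrix E $ v $ w = d v * signed_adj M E $ v $ w * d w" for v w
    using d(2)[of v w] matching_subset by (auto simp: adj_matrix_def signed_adj_def)
  with d(1) show ?thesis by (rule that)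
qed

lemma adj_matrix_inverse:
  obtains d where "\<And>v. d v = 1 \<or> d v = (- 1 :: real)"
    and "\<And>v w. matrix_inv (adj_matrix E) $ v $ w = d v * Q $ v $ w * d w"
    and "invertible (adj_matrix E)"
proof -
  obtain d where d: "\<And>v. d v = 1 \<or> d v = (- 1 :: real)"
    "\<And>v w. adj_matrix E $ v $ w = d v * signed_adj M E $ v $ w * d w" by (rule switching) blast
  define B where "B = (\<chi> v w. d v * Q $ v $ w * d w)"
  have sq: "d v * d v = 1" for v using d(1)[of v] by auto
  have "(adj_matrix E ** B) $ v $ w = d v * (signed_adj M E ** Q) $ v $ w * d w" for v w
  proof -
    have "adj_matrix E $ v $ u * B $ u $ w
        = d v * (signed_adj M E $ v $ u * Q $ u $ w) * d w * (d u * d u)" for u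
      by (simp add: d(2) B_def)
    then show ?thesis
      by (simp add: matrix_matrix_mult_def sq sum_distrib_left sum_distrib_right)
  qed
  then have AB: "adj_matrix E ** B = mat 1"
    by (simp add: signed_adj_path_matrix vec_eq_iff mat_def sq)
  then have "B ** adj_matrix E = mat 1" using matrix_left_right_inverse by blast
  with AB have inv: "invertible (adj_matrix E)" unfolding invertible_def by blast
  have "matrix_inv (adj_matrix E) $ v $ w = d v * Q $ v $ w * d w" for v w
    by (simp add: matrix_inv_eqI[OF AB] B_def)
  from that[OF d(1) this inv] show ?thesis .
qed

lemma inverse_graph_edge:
  "{a, b} \<in> inverse_graph E \<longleftrightarrow> a \<noteq> b \<and> Q $ a $ b \<noteq> 0"
proof -
  obtain d where d: "\<And>v. d v = 1 \<or> d v = (- 1 :: real)"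
    "\<And>v w. matrix_inv (adj_matrix E) $ v $ w = d v * Q $ v $ w * d w"
    by (rule adj_matrix_inverse) blast
  have nz: "matrix_inv (adj_matrix E) $ v $ w \<noteq> 0 \<longleftrightarrow> Q $ v $ w \<noteq> 0" for v w
    using d(1)[of v] d(1)[of w] by (auto simp: d(2))
  have sym: "Q $ v $ w = Q $ w $ v" for v w
    using arg_cong[OF path_matrix_symmetric, of "\<lambda>A. A $ w $ v"] by (simp add: transpose_def)
  show ?thesis
  proof
    assume "{a, b} \<in> inverse_graph E"
    then obtain x y where "{a, b} = {x, y}" "x \<noteq> y" "Q $ x $ y \<noteq> 0"
      unfolding inverse_graph_def nz by blast
    then show "a \<noteq> b \<and> Q $ a $ b \<noteq> 0" using sym[of x y] by (auto simp: doubleton_eq_iff)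
  next
    assume "a \<noteq> b \<and> Q $ a $ b \<noteq> 0"
    then show "{a, b} \<in> inverse_graph E" unfolding inverse_graph_def nz by blast
  qed
qed

lemma adj_eigenvalue_iff:
  assumes "\<mu> \<noteq> 0"
  shows "(\<exists>v. v \<noteq> 0 \<and> adj_matrix E *v v = \<mu> *\<^sub>R v) \<longleftrightarrow> (\<exists>v. v \<noteq> 0 \<and> Q *v v = (1 / \<mu>) *\<^sub>R v)"
proof -
  obtain d where d: "\<And>v. d v = 1 \<or> d v = (- 1 :: real)"
    "\<And>v w. adj_matrix E $ v $ w = d v * signed_adj M E $ v $ w * d w" by (rule switching) blast
  have sq: "d v * d v = 1" for v using d(1)[of v] by auto
  define D where "D v = (\<chi> i. d i * v $ i)" for v :: "real ^ 'a"
  have DD: "D (D v) = v" for v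
    by (simp add: D_def vec_eq_iff sq flip: mult.assoc)
  have D0: "D v = 0 \<longleftrightarrow> v = 0" for v
    by (metis DD D_def mult_zero_right vec_eq_iff vec_lambda_beta zero_index)
  have Dscale: "D (r *\<^sub>R v) = r *\<^sub>R D v" for r v
    by (simp add: D_def vec_eq_iff)
  have adj: "adj_matrix E *v v = D (signed_adj M E *v D v)" for v
    by (simp add: D_def vec_eq_iff matrix_vector_mult_def d(2) sum_distrib_left mult.assoc)
  have "adj_matrix E *v v = \<mu> *\<^sub>R v \<longleftrightarrow> Q *v D v = (1 / \<mu>) *\<^sub>R D v" for v
  proof -
    have "adj_matrix E *v v = \<mu> *\<^sub>R v \<longleftrightarrow> signed_adj M E *v D v = \<mu> *\<^sub>R D v"
      unfolding adj by (metis DD Dscale)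
    also have "\<dots> \<longleftrightarrow> D v = \<mu> *\<^sub>R (Q *v D v)"
      by (metis matrix_vector_mul_assoc matrix_vector_mul_lid matrix_vector_mult_scaleR
          signed_adj_path_matrix)
    also have "\<dots> \<longleftrightarrow> Q *v D v = (1 / \<mu>) *\<^sub>R D v"
      using assms by (auto simp: vec_eq_iff field_simps)
    finally show ?thesis .
  qed
  then show ?thesis by (metis D0 DD)
qed

text \<open>
  Negating the coordinates on one side of the bipartition conjugates \<open>A\<close> into \<open>- A\<close>, and the remaining
  sign \<open>(- 1) ^ CARD('a)\<close> is \<open>1\<close>.
\<close>

lemma charpoly_even:
  assumes "CARD('a) = 2 * n"
  shows "poly (charpoly (adj_matrix E)) (- x) = poly (charpoly (adj_matrix E)) x"
proof -
  obtain c :: "'a \<Rightarrow> real" where c: "\<And>v. c v = 1 \<or> c v = - 1"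
    "\<And>u v. {u, v} \<in> E \<Longrightarrow> c u = - c v" by (rule bipartition) blast
  have sq: "c v * c v = 1" for v using c(1)[of v] by auto
  define D :: "real ^ 'a ^ 'a" where "D = (\<chi> i j. if i = j then c i else 0)"
  let ?A = "mat x - adj_matrix E"
  have entry: "(mat (- x) - adj_matrix E) $ i $ j = - (c i * ?A $ i $ j * c j)" for i j
    using c(2)[of i j] sq[of i] sq[of j] no_loop[of i] by (auto simp: mat_def adj_matrix_def)
  have DAD: "(D ** ?A ** D) $ i $ j = c i * ?A $ i $ j * c j" for i j
    by (simp add: D_def matrix_matrix_mult_def if_distrib[of "\<lambda>z. z * _"] if_distrib[of "\<lambda>z. _ * z"] cong: if_cong)
  have "mat (- x) - adj_matrix E = mat (- 1) ** (D ** ?A ** D)"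
  proof -
    have neg: "(mat (- 1) ** B) $ i $ j = - (B $ i $ j)" for B :: "real ^ 'a ^ 'a" and i j
      by (simp add: matrix_matrix_mult_def mat_def if_distrib[of "\<lambda>z. z * _"] cong: if_cong)
    show ?thesis
      by (subst vec_eq_iff, intro allI, subst vec_eq_iff, intro allI) (simp only: neg DAD entry)
  qed
  then have "det (mat (- x) - adj_matrix E) = det (mat (- 1) :: real ^ 'a ^ 'a) * (det D * det ?A * det D)"
    by (simp only: det_mul)
  moreover have "det (mat (- 1) :: real ^ 'a ^ 'a) = 1"
    by (subst det_diagonal) (simp_all add: mat_def assms)
  ultimately have "det (mat (- x) - adj_matrix E) = (det D * det D) * det ?A"
    by (simp only: ac_simps mult_1_left mult_1_right)
  moreover have "det D * det D = 1"
    by (subst (1 2) det_diagonal) (simp_all add: D_def sq flip: prod.distrib)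
  ultimately show ?thesis by (simp only: poly_charpoly mult_1_left)
qed

text \<open>
  The spectrum is symmetric about \<open>0\<close> and avoids \<open>0\<close>, so half of the eigenvalues are positive and the
  middle index picks the least of them. Passing to the inverse, its reciprocal is the largest
  eigenvalue of the path matrix.
\<close>

lemma eig_least_positive:
  assumes card: "CARD('a) = 2 * n"
  shows "\<exists>v. v \<noteq> 0 \<and> Q *v v = (1 / eig n E) *\<^sub>R v" and "eig n E > 0"
    and "\<And>r. r > 0 \<Longrightarrow> \<exists>v. v \<noteq> 0 \<and> Q *v v = r *\<^sub>R v \<Longrightarrow> eig n E \<le> 1 / r"
proof -
  let ?p = "charpoly (adj_matrix E)"
  have p0: "?p \<noteq> 0" by (rule charpoly_monic)
  have sym: "transpose (adj_matrix E) = adj_matrix E"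
    by (simp add: transpose_def adj_matrix_def vec_eq_iff insert_commute)
  have size: "size (proots ?p) = 2 * n"
    using size_proots_real_rooted[OF p0] charpoly_symmetric_real_roots[OF sym] charpoly_monic(1)[of "adj_matrix E"] card
    by auto
  have "n > 0" using card by (metis mult_0_right neq0_conv zero_less_card_finite less_irrefl)
  moreover have root: "y \<in># proots ?p \<longleftrightarrow> (\<exists>v. v \<noteq> 0 \<and> adj_matrix E *v v = y *\<^sub>R v)" for y
    using p0 by (simp add: poly_charpoly_eq_0_iff)
  moreover have "0 \<notin># proots ?p"
  proof
    assume "0 \<in># proots ?p"
    then obtain v where v: "v \<noteq> 0" "adj_matrix E *v v = 0" unfolding root by auto
    have "invertible (adj_matrix E)" by (rule adj_matrix_inverse)
    then have "v = matrix_inv (adj_matrix E) *v (adj_matrix E *v v)"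
      by (simp add: matrix_vector_mul_assoc matrix_inv_inverse)
    with v show False by simp
  qed
  moreover have "count (proots ?p) (- a) = count (proots ?p) a" for a
    using order_even_poly[OF p0 charpoly_even[OF card]] p0 by simp
  ultimately have nth: "eig n E \<in># proots ?p" "eig n E > 0"
    "\<And>y. y \<in># proots ?p \<Longrightarrow> y > 0 \<Longrightarrow> eig n E \<le> y"
    using nth_of_symmetric_roots[OF size] unfolding eig_def by blast+
  show pos: "eig n E > 0" by (fact nth)
  show "\<exists>v. v \<noteq> 0 \<and> Q *v v = (1 / eig n E) *\<^sub>R v"
    using nth(1) pos unfolding root by (subst adj_eigenvalue_iff[symmetric]) auto
  show "eig n E \<le> 1 / r" if "r > 0" "\<exists>v. v \<noteq> 0 \<and> Q *v v = r *\<^sub>R v" for r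
    using that nth(3)[of "1 / r"] adj_eigenvalue_iff[of "1 / r"] unfolding root by auto
qed

lemma path_matrix_positive:
  shows "{v, w} \<in> M \<Longrightarrow> Q $ v $ w > 0" and "{mt v, mt w} \<in> E - M \<Longrightarrow> Q $ v $ w > 0"
proof -
  assume "{v, w} \<in> M"
  then have "w = mt v" by (simp add: matching_edge_iff)
  then show "Q $ v $ w > 0" using walk_matrix_diag[of v] by (simp add: path_matrix_def)
next
  assume "{mt v, mt w} \<in> E - M"
  then have "(v, mt w) \<in> {(x, y). arc x y}\<^sup>*" by (intro r_into_rtrancl) (simp add: alt_arc_def)
  then have "W $ v $ v \<le> W $ v $ mt w" by (rule walk_matrix_mono_target)
  then show "Q $ v $ w > 0" using walk_matrix_diag[of v] by (simp add: path_matrix_def)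
qed

text \<open>
  The positivity half of the Perron--Frobenius theorem. The zero set of \<open>y\<close> is closed under taking
  neighbours in the inverse graph. It is then closed under neighbours in \<open>E\<close>: across a matching edge
  directly, and across another edge \<open>{u, w}\<close> by the steps \<open>u\<close>, \<open>mt u\<close>, \<open>mt w\<close>, \<open>w\<close>, whose middle one
  comes from the arc of that edge.
\<close>

lemma nonneg_eigenvector_positive:
  assumes conn: "graph_connected E" and ev: "Q *v y = l *\<^sub>R y" and y: "y \<noteq> 0" "\<And>v. y $ v \<ge> 0"
  shows "y $ v > 0"
proof (rule ccontr)
  assume "\<not> y $ v > 0"
  with y(2)[of v] have zero: "y $ v = 0" by simp
  have step: "y $ w = 0" if u: "y $ u = 0" and Q: "Q $ u $ w > 0" for u w
  proof -
    have "(\<Sum>x\<in>UNIV. Q $ u $ x * y $ x) = 0"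
      using arg_cong[OF ev, of "\<lambda>z. z $ u"] u by (simp add: matrix_vector_mult_def)
    then have "Q $ u $ w * y $ w = 0"
      by (subst (asm) sum_nonneg_eq_0_iff) (auto simp: path_matrix_nonneg y(2))
    with Q show ?thesis by simp
  qed
  have edge: "y $ w = 0" if u: "y $ u = 0" and uw: "{u, w} \<in> E" for u w
  proof (cases "{u, w} \<in> M")
    case True
    then show ?thesis using step[OF u] path_matrix_positive(1) by blast
  next
    case False
    have mate_zero: "y $ mt x = 0" if "y $ x = 0" for x
      by (rule step[OF that path_matrix_positive(1)[OF mate_in_matching]])
    have "y $ mt w = 0"
      by (rule step[OF mate_zero[OF u] path_matrix_positive(2)]) (use uw False in simp)
    then show ?thesis using mate_zero[of "mt w"] by simp
  qed
  have "y $ w = 0" for w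
  proof -
    have "(v, w) \<in> {(x, y). {x, y} \<in> E}\<^sup>*" using conn unfolding graph_connected_def by blast
    then show ?thesis by (induction rule: rtrancl_induct) (use zero edge in auto)
  qed
  with y(1) show False by (simp add: vec_eq_iff)
qed

text \<open>
  The edge under the arc from \<open>k\<close> to \<open>l\<close> carries one more arc, from \<open>mt l\<close> to \<open>mt k\<close>. A walk from \<open>l\<close>
  cannot use the first because heights grow along arcs, nor the second because it lies in the
  other colour class.
\<close>

lemma walk_after_arc_avoids_edge:
  assumes kl: "arc k l" and walk: "(l, z) \<in> {(x, y). arc x y}\<^sup>*"
  shows "(l, z) \<in> {(x, y). alt_arc M (E - {{mt k, l}}) x y}\<^sup>*"
proof -
  obtain H :: "'a \<Rightarrow> real" where H: "\<And>v w. arc v w \<Longrightarrow> H w = H v + 1" by (rule height) blast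
  obtain c :: "'a \<Rightarrow> real" where c: "\<And>v. c v = 1 \<or> c v = - 1"
    "\<And>u v. {u, v} \<in> E \<Longrightarrow> c u = - c v" by (rule bipartition) blast
  have c_mate: "c (mt v) = - c v" for v
    using c(2)[of v "mt v"] mate_in_matching[of v] matching_subset by auto
  have c_arc: "c w = c v" if "arc v w" for v w
    using c(2)[of "mt v" w] that c_mate[of v] by (simp add: alt_arc_def)
  from walk have "(l, z) \<in> {(x, y). alt_arc M (E - {{mt k, l}}) x y}\<^sup>* \<and> H l \<le> H z \<and> c z = c l"
  proof (induction rule: rtrancl_induct)
    case (step v w)
    have arc: "arc v w" and IH: "(l, v) \<in> {(x, y). alt_arc M (E - {{mt k, l}}) x y}\<^sup>*"
      "H l \<le> H v" "c v = c l" using step by auto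
    have "{mt v, w} \<noteq> {mt k, l}"
    proof
      assume "{mt v, w} = {mt k, l}"
      then consider "v = k" | "w = mt k" by (auto simp: doubleton_eq_iff)
      then show False
      proof cases
        case 1
        then show ?thesis using H[OF kl] IH by simp
      next
        case 2
        then have "c l = - c k" using c_arc[OF arc] IH(3) c_mate[of k] by simp
        then show ?thesis using c_arc[OF kl] c(1)[of k] by auto
      qed
    qed
    with arc have "(v, w) \<in> {(x, y). alt_arc M (E - {{mt k, l}}) x y}" by (simp add: alt_arc_def)
    with IH(1) show ?case using H[OF arc] c_arc[OF arc] IH(2,3)
      by (auto intro: rtrancl_into_rtrancl)
  qed simp
  then show ?thesis ..
qed

end

section \<open>The largest eigenvalue of a symmetric matrix\<close>

lemma inner_matrix_vector_sum:
  fixes A :: "real ^ 'a ^ 'a"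
  shows "x \<bullet> (A *v y) = (\<Sum>i\<in>UNIV. \<Sum>j\<in>UNIV. x $ i * A $ i $ j * y $ j)"
  by (simp add: inner_vec_def matrix_vector_mult_def sum_distrib_left mult.assoc)

text \<open>
  The maximum of the quadratic form on the unit sphere. Where \<open>l * (x \<bullet> x) - x \<bullet> (A *v x)\<close> attains its
  minimum \<open>0\<close>, moving from \<open>x\<close> against the residual \<open>l *\<^sub>R x - A *v x\<close> would make it negative
  unless the residual vanishes.
\<close>

lemma maximal_eigenvalue:
  fixes A :: "real ^ 'a::finite ^ 'a"
  assumes sym: "transpose A = A"
  obtains l where "\<exists>x. x \<noteq> 0 \<and> A *v x = l *\<^sub>R x"
    and "\<And>x. x \<bullet> (A *v x) \<le> l * (x \<bullet> x)"
    and "\<And>x. x \<bullet> (A *v x) = l * (x \<bullet> x) \<Longrightarrow> A *v x = l *\<^sub>R x"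
proof -
  have "sphere (0 :: real ^ 'a) 1 \<noteq> {}" by simp
  moreover have "continuous_on (sphere 0 1) (\<lambda>x. x \<bullet> (A *v x))"
    by (intro continuous_intros matrix_vector_mult_linear_continuous_on)
  ultimately obtain x0 where x0: "x0 \<in> sphere 0 1"
    "\<And>x. x \<in> sphere 0 1 \<Longrightarrow> x \<bullet> (A *v x) \<le> x0 \<bullet> (A *v x0)"
    using continuous_attains_sup[OF compact_sphere] by blast
  define l where "l = x0 \<bullet> (A *v x0)"
  have le: "x \<bullet> (A *v x) \<le> l * (x \<bullet> x)" for x
  proof (cases "x = 0")
    case False
    define u where "u = (1 / norm x) *\<^sub>R x"
    have "u \<in> sphere 0 1" using False by (simp add: u_def)
    then have "u \<bullet> (A *v u) \<le> l" unfolding l_def by (rule x0(2))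
    moreover have x: "x = norm x *\<^sub>R u" using False by (simp add: u_def)
    have "x \<bullet> (A *v x) = (norm x)\<^sup>2 * (u \<bullet> (A *v u))"
      by (subst (1 2) x) (simp add: matrix_vector_mult_scaleR power2_eq_square)
    moreover have "x \<bullet> x = (norm x)\<^sup>2" by (simp add: power2_norm_eq_inner)
    ultimately show ?thesis using mult_right_mono[of _ l "(norm x)\<^sup>2"] by (simp add: mult.commute)
  qed simp
  have eigen: "A *v x = l *\<^sub>R x" if eq: "x \<bullet> (A *v x) = l * (x \<bullet> x)" for x
  proof (rule ccontr)
    assume "A *v x \<noteq> l *\<^sub>R x"
    define r where "r = l *\<^sub>R x - A *v x"
    define b where "b = l * (r \<bullet> r) - r \<bullet> (A *v r)"
    define s where "s = r \<bullet> r"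
    have s: "s > 0" using \<open>A *v x \<noteq> l *\<^sub>R x\<close> by (simp add: s_def r_def)
    have b: "b \<ge> 0" using le[of r] by (simp add: b_def)
    \<comment> \<open>At \<open>x + t *\<^sub>R r\<close> the defect \<open>l * (z \<bullet> z) - z \<bullet> (A *v z)\<close> is \<open>2 * t * s + t * t * b\<close>, negative for this \<open>t\<close>.\<close>
    define t where "t = - s / (b + 1)"
    have xr: "x \<bullet> (A *v r) = r \<bullet> (A *v x)"
      using inner_symmetric_matrix[OF sym, of x r] by (simp add: inner_commute)
    have rs: "r \<bullet> (A *v x) = l * (r \<bullet> x) - s"
      by (simp add: s_def r_def inner_diff_right)
    have "(x + t *\<^sub>R r) \<bullet> (A *v (x + t *\<^sub>R r)) \<le> l * ((x + t *\<^sub>R r) \<bullet> (x + t *\<^sub>R r))"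
      by (rule le)
    then have "0 \<le> 2 * t * s + t * t * b"
      by (simp add: matrix_vector_right_distrib matrix_vector_mult_scaleR inner_add_left
          inner_add_right xr rs eq b_def inner_commute[of x r] algebra_simps)
    also have "2 * t * s + t * t * b = t * s + t * (t * (b + 1) + s) - t * t"
      by (simp add: algebra_simps)
    also have "t * (b + 1) + s = 0" using b by (simp add: t_def)
    also have "t * s + t * 0 - t * t < 0"
    proof -
      have "t < 0" using s b by (simp add: t_def)
      then have "t * s < 0" using s by (rule mult_neg_pos)
      then show ?thesis using zero_le_square[of t] by linarith
    qed
    finally show False by simp
  qed
  have "x0 \<bullet> x0 = 1" "x0 \<noteq> 0" using x0(1) by (auto simp: norm_eq_1)
  then have "A *v x0 = l *\<^sub>R x0" by (intro eigen) (simp add: l_def)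
  with \<open>x0 \<noteq> 0\<close> show ?thesis by (intro that[of l] le eigen) auto
qed

section \<open>The effect of a tree-exchange\<close>

text \<open>
  The edge with ends \<open>m x\<close> and \<open>m y\<close> underlies two arcs, from \<open>x\<close> to \<open>m y\<close> and from \<open>y\<close> to \<open>m x\<close>.
\<close>

lemma sum_over_edge_ends:
  fixes F :: "'a::finite \<Rightarrow> 'a \<Rightarrow> real"
  assumes inv: "\<And>v. m (m v) = v" and "x \<noteq> y"
  shows "(\<Sum>p\<in>UNIV. \<Sum>q\<in>UNIV. (if {m p, q} = {m x, m y} then F p q else 0))
    = F x (m y) + F y (m x)"
proof -
  have inj: "m u = m v \<longleftrightarrow> u = v" for u v by (metis inv)
  have "(if {m p, q} = {m x, m y} then F p q else 0)
      = (if q = m y then if p = x then F p q else 0 else 0) + (if q = m x then if p = y then F p q else 0 else 0)" for p q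
    using assms(2) by (auto simp: doubleton_eq_iff inj)
  then show ?thesis by (simp add: sum.distrib)
qed

lemma rtrancl_leaves_set:
  assumes "(a, z) \<in> r\<^sup>*" "(a \<in> X) \<noteq> (z \<in> X)"
  shows "\<exists>v w. (a, v) \<in> r\<^sup>* \<and> (v, w) \<in> r \<and> (w, z) \<in> r\<^sup>* \<and> (v \<in> X) \<noteq> (w \<in> X)"
  using assms
proof (induction rule: rtrancl_induct)
  case (step y z)
  show ?case
  proof (cases "(a \<in> X) = (y \<in> X)")
    case True
    then show ?thesis using step by blast
  next
    case False
    with step.IH obtain v w where "(a, v) \<in> r\<^sup>*" "(v, w) \<in> r" "(w, y) \<in> r\<^sup>*" "(v \<in> X) \<noteq> (w \<in> X)"
      by blast
    then show ?thesis using step.hyps(2) by (meson rtrancl.rtrancl_into_rtrancl)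
  qed
qed simp

lemma exchange_matched_forest:
  assumes T: "matched_forest M T" and e: "e \<in> inverse_graph T" "e \<notin> phi_graph M T"
    and cyc: "is_cycle (insert (mate M ` e) T) C" and f: "f \<in> T" "f \<notin> M" "f \<in> C"
  shows "mate M ` e \<notin> T" and "matched_forest M (tau M T e f)"
proof -
  interpret matched_forest M T by (rule T)
  have invol: "mate M ` mate M ` h = h" for h by (simp add: image_image)
  show g: "mate M ` e \<notin> T"
    using e(2) invol unfolding phi_graph_def by (metis imageI)
  obtain a b where "e = {a, b}" "a \<noteq> b" using e(1) unfolding inverse_graph_def by blast
  then have "card (mate M ` e) = 2" by simp
  then have simple': "simple_graph (insert (mate M ` e) T)" using simple by (simp add: simple_graph_def)
  show "matched_forest M (tau M T e f)"
  proof
    show "simple_graph (tau M T e f)" using simple' unfolding simple_graph_def tau_def by blast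
    show "cut_forest (tau M T e f)"
      unfolding tau_def by (rule cut_forest_exchange[OF simple' forest g cyc f(1,3)])
    have "M \<subseteq> tau M T e f" using matching_subset f(2) unfolding tau_def by blast
    then show "perfect_matching (tau M T e f) M" using matching unfolding perfect_matching_def by blast
  qed
qed

text \<open>
  Write \<open>e = {a, b}\<close>. The alternating path for \<open>e\<close> is a walk of arcs from \<open>a\<close> to \<open>mate M b\<close>, and the
  exchange adds the shortcut arc from \<open>a\<close> to \<open>mate M b\<close> and deletes an arc from \<open>k\<close> to \<open>l\<close> on that
  walk, together with the reverse copies of both. For walk matrices \<open>W = (I - R)\<^sup>-\<^sup>1\<close> and
  \<open>W' = (I - R')\<^sup>-\<^sup>1\<close> there is the resolvent identity \<open>W - W' = W (R - R') W'\<close>. Its right-hand side is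
  nonnegative, because every walk of the old forest ending in \<open>a\<close> extends to \<open>k\<close>, and every walk of the
  new forest starting in \<open>mate M b\<close> can be prefixed by the stretch from \<open>l\<close>, which survives the
  exchange.
\<close>

lemma path_matrix_exchange:
  assumes T: "matched_forest M T" and e: "e \<in> inverse_graph T" "e \<notin> phi_graph M T"
    and cyc: "is_cycle (insert (mate M ` e) T) C" and f: "f \<in> T" "f \<notin> M" "f \<in> C"
  shows "path_matrix M (tau M T e f) $ v $ w \<le> path_matrix M T $ v $ w"
    and "path_matrix M (tau M T e f) \<noteq> path_matrix M T"
proof -
  define T' where "T' = tau M T e f"
  have g: "mate M ` e \<notin> T" and T': "matched_forest M T'"
    using exchange_matched_forest[OF assms] by (simp_all add: T'_def)
  interpret T: matched_forest M T by (rule T)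
  interpret T': matched_forest M T' by (rule T')
  let ?m = "mate M"
  let ?arcs = "{(x, y). alt_arc M T x y}" and ?arcs' = "{(x, y). alt_arc M T' x y}"
  obtain a b where ab: "e = {a, b}" "a \<noteq> b" using e(1) unfolding inverse_graph_def by blast
  have T'_eq: "T' = insert {?m a, ?m b} T - {f}" by (simp add: T'_def tau_def ab)
  have gT: "{?m a, ?m b} \<notin> T" using g by (simp add: ab)
  have "path_matrix M T $ a $ b \<noteq> 0" using e(1) unfolding ab T.inverse_graph_edge by simp
  then have walk: "(a, ?m b) \<in> ?arcs\<^sup>*"
    unfolding path_matrix_def by (intro T.walk_if_entry_nonzero) simp
  \<comment> \<open>The cut of \<open>f\<close> separates the ends of the walk, so the walk uses an arc over \<open>f\<close>.\<close>
  obtain X where X: "crosses X f" "\<And>h. h \<in> T \<Longrightarrow> h \<noteq> f \<Longrightarrow> \<not> crosses X h"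
    using T.forest f(1) unfolding cut_forest_def by blast
  obtain h where "h \<in> C" "h \<noteq> f" "crosses X h"
    using cycle_crosses_twice[OF cyc f(3) X(1)] by blast
  moreover have "C \<subseteq> insert {?m a, ?m b} T" using cyc unfolding is_cycle_def ab by simp
  ultimately have "crosses X {?m a, ?m b}" using X(2) by blast
  moreover have mate_side: "u \<in> X \<longleftrightarrow> ?m u \<in> X" for u
    using X(2)[of "{u, ?m u}"] T.mate_in_matching[of u] T.matching_subset f(2) by (metis crosses_pair subsetD)
  ultimately have "(a \<in> X) \<noteq> (?m b \<in> X)" by simp
  then obtain k l where kl: "(a, k) \<in> ?arcs\<^sup>*" "alt_arc M T k l" "(l, ?m b) \<in> ?arcs\<^sup>*"
    "(k \<in> X) \<noteq> (l \<in> X)"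
    using rtrancl_leaves_set[OF walk] by blast
  then have f_eq: "f = {?m k, l}"
    using X(2)[of "{?m k, l}"] mate_side[of k] unfolding alt_arc_def by auto
  have flipped: "alt_arc M T (?m l) (?m k)" using kl(2) T.arc_reverse by blast
  have sub: "{(x, y). alt_arc M (T - {f}) x y} \<subseteq> ?arcs'"
    by (auto simp: alt_arc_def T'_eq)
  have tail: "(l, ?m b) \<in> ?arcs'\<^sup>*"
    using T.walk_after_arc_avoids_edge[OF kl(2,3)] rtrancl_mono[OF sub] unfolding f_eq by blast
  have tail': "(?m k, ?m a) \<in> ?arcs'\<^sup>*"
    using T.walk_after_arc_avoids_edge[OF flipped T.arcs_reverse[OF kl(1)]] rtrancl_mono[OF sub]
    unfolding f_eq by (auto simp: insert_commute)
  have head': "(b, ?m l) \<in> ?arcs\<^sup>*" using T.arcs_reverse[OF kl(3)] by simp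
  have "k \<noteq> ?m l"
    using T.no_loop[of l] f(1) unfolding f_eq by auto
  have le: "walk_matrix M T' $ v $ w \<le> walk_matrix M T $ v $ w" for v w
  proof -
    let ?W = "walk_matrix M T" and ?W' = "walk_matrix M T'"
    let ?R = "arc_matrix M T" and ?R' = "arc_matrix M T'"
    let ?F = "\<lambda>p q. ?W $ v $ p * ?W' $ q $ w"
    have diff: "?W ** (mat 1 - ?R') ** ?W' - ?W ** (mat 1 - ?R) ** ?W' = ?W - ?W'"
      by (simp add: T.walk_matrix_inverse T'.walk_matrix_inverse flip: matrix_mul_assoc)
    have entry: "(?W ** B ** ?W') $ v $ w = (\<Sum>q\<in>UNIV. \<Sum>p\<in>UNIV. B $ p $ q * ?F p q)" for B
      by (simp add: matrix_matrix_mult_def sum_distrib_right sum_distrib_left ac_simps)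
    have "?W $ v $ w - ?W' $ v $ w
        = (\<Sum>q\<in>UNIV. \<Sum>p\<in>UNIV. (mat 1 - ?R') $ p $ q * ?F p q) - (\<Sum>q\<in>UNIV. \<Sum>p\<in>UNIV. (mat 1 - ?R) $ p $ q * ?F p q)"
      unfolding entry[symmetric] by (simp only: vector_minus_component[symmetric] diff)
    also have "\<dots> = (\<Sum>q\<in>UNIV. \<Sum>p\<in>UNIV. (?R $ p $ q - ?R' $ p $ q) * ?F p q)"
      by (simp add: left_diff_distrib flip: sum_subtractf)
    also have "\<dots> = (\<Sum>p\<in>UNIV. \<Sum>q\<in>UNIV. (?R $ p $ q - ?R' $ p $ q) * ?F p q)"
      by (rule sum.swap)
    also have "\<dots> = (\<Sum>p\<in>UNIV. \<Sum>q\<in>UNIV. (if {?m p, q} = {?m k, ?m (?m l)} then ?F p q else 0)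
        - (if {?m p, q} = {?m a, ?m b} then ?F p q else 0))"
    proof (intro sum.cong refl)
      fix p q
      have "?R $ p $ q - ?R' $ p $ q = (if {?m p, q} = f then 1 else 0) - (if {?m p, q} = {?m a, ?m b} then 1 else 0)"
        using gT f(1,2) T.matching_subset unfolding arc_matrix_def alt_arc_def T'_eq by auto
      then show "(?R $ p $ q - ?R' $ p $ q) * ?F p q
          = (if {?m p, q} = {?m k, ?m (?m l)} then ?F p q else 0) - (if {?m p, q} = {?m a, ?m b} then ?F p q else 0)"
        unfolding f_eq by simp
    qed
    also have "\<dots> = (?F k l + ?F (?m l) (?m k)) - (?F a (?m b) + ?F b (?m a))"
      using sum_over_edge_ends[of ?m k "?m l" ?F] sum_over_edge_ends[of ?m a b ?F] \<open>k \<noteq> ?m l\<close> ab(2)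
      by (simp add: sum_subtractf)
    also have "\<dots> \<ge> 0"
    proof -
      have "?F a (?m b) \<le> ?F k l"
        by (intro mult_mono T.walk_matrix_mono_target[OF kl(1)] T'.walk_matrix_mono_source[OF tail]
            T.walk_matrix_nonneg T'.walk_matrix_nonneg)
      moreover have "?F b (?m a) \<le> ?F (?m l) (?m k)"
        by (intro mult_mono T.walk_matrix_mono_target[OF head'] T'.walk_matrix_mono_source[OF tail']
            T.walk_matrix_nonneg T'.walk_matrix_nonneg)
      ultimately show ?thesis by simp
    qed
    finally show ?thesis by simp
  qed
  then show "path_matrix M (tau M T e f) $ v $ w \<le> path_matrix M T $ v $ w"
    by (simp add: path_matrix_def flip: T'_def)
  show "path_matrix M (tau M T e f) \<noteq> path_matrix M T"
  proof
    assume "path_matrix M (tau M T e f) = path_matrix M T"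
    then have "signed_adj M T ** path_matrix M T' = mat 1"
      using T.signed_adj_path_matrix by (simp add: T'_def)
    then have "signed_adj M T = signed_adj M T'"
      by (metis T'.signed_adj_path_matrix(2) matrix_mul_assoc matrix_mul_lid matrix_mul_rid)
    then have "signed_adj M T $ ?m a $ ?m b = signed_adj M T' $ ?m a $ ?m b" by simp
    moreover have "{?m a, ?m b} \<noteq> f" "{?m a, ?m b} \<notin> M" using gT f(1) T.matching_subset by auto
    ultimately show False using gT by (simp add: signed_adj_def T'_eq)
  qed
qed


theorem corollary4p2:
  fixes T T' :: "'a::finite set set" and n :: nat
  assumes "CARD('a) = 2 * n"
    and "is_tree T"
    and "invertible (adj_matrix T)"
    and "tree_exchange T T'"
  shows "eig n T < eig n T'"
proof -
  obtain M e f C where matching: "perfect_matching T M"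
    and e: "e \<in> inverse_graph T" "e \<notin> phi_graph M T"
    and cyc: "is_cycle (insert (mate M ` e) T) C" and f: "f \<in> T" "f \<notin> M" "f \<in> C"
    and T'_eq: "T' = tau M T e f"
    using assms(4) unfolding tree_exchange_def by blast
  have T: "matched_forest M T"
    using assms(2) matching tree_imp_cut_forest[OF assms(2)]
    unfolding matched_forest_def is_tree_def by blast
  have T': "matched_forest M T'"
    unfolding T'_eq by (rule exchange_matched_forest(2)[OF T e cyc f])
  interpret T: matched_forest M T by (rule T)
  interpret T': matched_forest M T' by (rule T')
  let ?Q = "path_matrix M T" and ?Q' = "path_matrix M T'"
  have Q_le: "?Q' $ i $ j \<le> ?Q $ i $ j" for i j
    unfolding T'_eq by (rule path_matrix_exchange(1)[OF T e cyc f])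
  have Q_ne: "?Q' \<noteq> ?Q"
    unfolding T'_eq by (rule path_matrix_exchange(2)[OF T e cyc f])
  obtain l where l: "\<exists>x. x \<noteq> 0 \<and> ?Q *v x = l *\<^sub>R x"
    and l_max: "\<And>x. x \<bullet> (?Q *v x) \<le> l * (x \<bullet> x)"
    and l_eq: "\<And>x. x \<bullet> (?Q *v x) = l * (x \<bullet> x) \<Longrightarrow> ?Q *v x = l *\<^sub>R x"
    using maximal_eigenvalue[OF T.path_matrix_symmetric] by blast
  define r where "r = 1 / eig n T'"
  have r: "r > 0" using T'.eig_least_positive(2)[OF assms(1)] by (simp add: r_def)
  obtain z where z: "z \<noteq> 0" "?Q' *v z = r *\<^sub>R z"
    using T'.eig_least_positive(1)[OF assms(1)] unfolding r_def by blast
  \<comment> \<open>Passing to absolute values does not decrease the form of the nonnegative matrix \<open>?Q'\<close>.\<close>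
  define y where "y = (\<chi> i. \<bar>z $ i\<bar>)"
  have y_nonneg: "0 \<le> y $ i" for i by (simp add: y_def)
  have yy: "y \<bullet> y = z \<bullet> z" by (simp add: y_def inner_vec_def)
  have y0: "y \<noteq> 0" using yy z(1) by (metis inner_eq_zero_iff)
  have pos: "y \<bullet> y > 0" using y0 by simp
  have "r * (y \<bullet> y) = z \<bullet> (?Q' *v z)" by (simp add: z(2) yy)
  also have "\<dots> \<le> y \<bullet> (?Q' *v y)"
    unfolding inner_matrix_vector_sum
  proof (intro sum_mono)
    fix i j
    have "z $ i * ?Q' $ i $ j * z $ j \<le> \<bar>z $ i * ?Q' $ i $ j * z $ j\<bar>" by simp
    also have "\<dots> = y $ i * ?Q' $ i $ j * y $ j"
      using T'.path_matrix_nonneg[of i j] by (simp add: y_def abs_mult)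
    finally show "z $ i * ?Q' $ i $ j * z $ j \<le> y $ i * ?Q' $ i $ j * y $ j" .
  qed
  finally have low: "r * (y \<bullet> y) \<le> y \<bullet> (?Q' *v y)" .
  have term_le: "y $ i * ?Q' $ i $ j * y $ j \<le> y $ i * ?Q $ i $ j * y $ j" for i j
    by (intro mult_right_mono mult_left_mono Q_le y_nonneg)
  have up: "y \<bullet> (?Q' *v y) \<le> y \<bullet> (?Q *v y)"
    unfolding inner_matrix_vector_sum by (intro sum_mono term_le)
  have "r * (y \<bullet> y) \<le> l * (y \<bullet> y)" using low up l_max[of y] by linarith
  then have "r \<le> l" using pos by simp
  moreover have "r \<noteq> l"
  proof
    \<comment> \<open>Equality would make \<open>y\<close> a positive eigenvector of \<open>?Q\<close>, whose form drops whenever an entry drops.\<close>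
    assume "r = l"
    then have eq: "y \<bullet> (?Q *v y) = l * (y \<bullet> y)" "y \<bullet> (?Q' *v y) = y \<bullet> (?Q *v y)"
      using low up l_max[of y] by auto
    have conn: "graph_connected T" using assms(2) by (simp add: is_tree_def)
    have y_pos: "y $ i > 0" for i
      by (rule T.nonneg_eigenvector_positive[OF conn l_eq[OF eq(1)] y0 y_nonneg])
    have "?Q' $ i $ j = ?Q $ i $ j" for i j
    proof (rule ccontr)
      assume "?Q' $ i $ j \<noteq> ?Q $ i $ j"
      then have strict: "y $ i * ?Q' $ i $ j * y $ j < y $ i * ?Q $ i $ j * y $ j"
        using Q_le[of i j] y_pos by simp
      have "(\<Sum>j\<in>UNIV. y $ i * ?Q' $ i $ j * y $ j) < (\<Sum>j\<in>UNIV. y $ i * ?Q $ i $ j * y $ j)"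
        using strict term_le by (intro sum_strict_mono_ex1) auto
      then have "(\<Sum>i\<in>UNIV. \<Sum>j\<in>UNIV. y $ i * ?Q' $ i $ j * y $ j)
          < (\<Sum>i\<in>UNIV. \<Sum>j\<in>UNIV. y $ i * ?Q $ i $ j * y $ j)"
        using term_le by (intro sum_strict_mono_ex1) (auto intro: sum_mono)
      then show False using eq(2) unfolding inner_matrix_vector_sum by simp
    qed
    with Q_ne show False by (simp add: vec_eq_iff)
  qed
  ultimately have "r < l" by simp
  with r have "l > 0" by linarith
  have "eig n T \<le> 1 / l" by (rule T.eig_least_positive(3)[OF assms(1) \<open>l > 0\<close> l])
  also have "\<dots> < 1 / r" using \<open>r < l\<close> r by (simp add: frac_less2)
  finally show ?thesis by (simp add: r_def)
qed

end
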